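(* Let $C$ and $C'$ be multi-model Cantor sets with irreducible matrices. If there is a bilipschitz map of $C$ onto a clopen in $C'$, then $C$ and $C'$ have the same clopen invariant.
   Context: A subset that is both open and closed is called a clopen. A surjective map $f:X\to Y$ of metric spaces is a similarity map with scale factor $K>0$ if $d_Y(f(x_1),f(x_2))=K\,d_X(x_1,x_2)$ for all $x_1,x_2\in X$. A map $f:X\to Y$ of metric spaces is bilipschitz if for some constant $K>0$ one has $\frac1K d_X(x_1,x_2)\le d_Y(f(x_1),f(x_2))\le K d_X(x_1,x_2)$ for all $x_1,x_2\in X$. Multi-model Cantor set: a metric space $C$ which is a Cantor set (compact, totally disconnected, perfect, non-empty) together with the following data (a clone structure). There is a partition of $C$ into non-empty clopens $A_1,\dots,A_n$ (the models) and another partition of $C$ into non-empty clopens $E_1,\dots,E_m$ (the level-1 clones), such that each $E_i$ is contained in some $A_j$ and each $A_j$ contains at least two of the $E_i$. For each $i$ there is given a surjective similarity map $\tau_i:E_i\to A_j$ onto some model $A_j$ (with $j$ depending on $i$), called a clone map; its scale factor is greater than $1$. The level-1 clone $E_i$ is said to be of type $j$ if $\tau_i$ maps it onto $A_j$. Matrix: for $d>0$, $M_d$ is the $n\times n$ matrix whose $(i,j)$ entry is the sum of the $d$-th powers of the inverses of the scale factors of the clone maps of those level-1 clones that are of type $i$ and are contained in the model $A_j$ (an empty sum being $0$). A square matrix $M$ is irreducible if all its entries are non-negative and there is some $k>0$ such that all entries of $M^k$ are positive; $C$ has irreducible matrix if $M_d$ is irreducible (this does not depend on $d$). Clopen invariant: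 two sets of real numbers $S,T$ are similar if there exist non-zero scalars $\alpha,\beta$ with $\alpha S\subset T$ and $\beta T\subset S$. Let $\delta$ be the Hausdorff dimension of $C$ and $\mathcal{H}_\delta$ the $\delta$-dimensional Hausdorff measure. The clopen invariant of $C$ is the similarity class of the countable set of real numbers $\{\mathcal{H}_\delta(U): U \text{ a clopen in } A_j\}$, for any choice of model $A_j$ (for irreducible matrices the class does not depend on $j$). *)

theory Defs
  imports "HOL-Analysis.Analysis" "Jordan_Normal_Form.Matrix"
begin

text \<open>Metric spaces are represented as subsets of types of class \<open>metric_space\<close>, with the
  induced metric and the subspace topology.\<close>

subsection \<open>Clopens, Cantor sets, maps of metric spaces\<close>

definition clopen_in :: "'a::metric_space set \<Rightarrow> 'a set \<Rightarrow> bool" where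
  "clopen_in X U \<longleftrightarrow> openin (top_of_set X) U \<and> closedin (top_of_set X) U"

definition totally_disconnected :: "'a::metric_space set \<Rightarrow> bool" where
  "totally_disconnected X \<longleftrightarrow> (\<forall>S\<subseteq>X. connected S \<longrightarrow> (\<exists>a. S \<subseteq> {a}))"

definition cantor_set :: "'a::metric_space set \<Rightarrow> bool" where
  "cantor_set C \<longleftrightarrow>
     compact C \<and> totally_disconnected C \<and> (\<forall>x\<in>C. x islimpt C) \<and> C \<noteq> {}"

definition similarity_map ::
    "'a::metric_space set \<Rightarrow> 'b::metric_space set \<Rightarrow> ('a \<Rightarrow> 'b) \<Rightarrow> real \<Rightarrow> bool" where
  "similarity_map X Y f K \<longleftrightarrow>
     K > 0 \<and> f ` X = Y \<and> (\<forall>x1\<in>X. \<forall>x2\<in>X. dist (f x1) (f x2) = K * dist x1 x2)"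

definition bilipschitz_on :: "'a::metric_space set \<Rightarrow> ('a \<Rightarrow> 'b::metric_space) \<Rightarrow> bool" where
  "bilipschitz_on X f \<longleftrightarrow>
     (\<exists>K>0. \<forall>x1\<in>X. \<forall>x2\<in>X.
        1 / K * dist x1 x2 \<le> dist (f x1) (f x2) \<and> dist (f x1) (f x2) \<le> K * dist x1 x2)"

subsection \<open>Hausdorff measure and dimension\<close>

text \<open>The \<open>s\<close>-th power of the diameter. The convention \<open>0\<^sup>0 = 1\<close> for non-empty sets makes the
  \<open>0\<close>-dimensional Hausdorff measure the counting measure; \<open>powr\<close> alone would give \<open>0\<close>.\<close>

definition diam_power :: "real \<Rightarrow> 'a::metric_space set \<Rightarrow> ennreal" where
  "diam_power s V =
     (if V = {} then 0 else if s = 0 then 1 else ennreal (diameter V powr s))"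

text \<open>Boundedness of the covering sets is required explicitly because \<open>diameter\<close> is \<open>0\<close> on
  unbounded sets.\<close>

definition hausdorff_premeasure :: "real \<Rightarrow> real \<Rightarrow> 'a::metric_space set \<Rightarrow> ennreal" where
  "hausdorff_premeasure s \<epsilon> X =
     (INF V \<in> {V :: nat \<Rightarrow> 'a set. X \<subseteq> (\<Union>i. V i) \<and> (\<forall>i. bounded (V i) \<and> diameter (V i) \<le> \<epsilon>)}.
        \<Sum>i. diam_power s (V i))"

definition hausdorff_measure :: "real \<Rightarrow> 'a::metric_space set \<Rightarrow> ennreal" where
  "hausdorff_measure s X = (SUP \<epsilon> \<in> {0<..}. hausdorff_premeasure s \<epsilon> X)"

definition hausdorff_dimension :: "'a::metric_space set \<Rightarrow> ennreal" where
  "hausdorff_dimension X = (INF s \<in> {s. 0 \<le> s \<and> hausdorff_measure s X = 0}. ennreal s)"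

subsection \<open>Multi-model Cantor sets\<close>

text \<open>\<open>A j\<close> (\<open>j < n\<close>) are the models, \<open>E i\<close> (\<open>i < m\<close>) the level-1 clones and \<open>\<tau> i\<close> the clone
  maps, relevant on \<open>E i\<close> only. The scale factor \<open>\<rho> i\<close> is not additional data: it is determined
  by \<open>\<tau> i\<close>, since a non-empty clopen of a perfect set has more than one point.\<close>

locale multi_model_cantor_set =
  fixes C :: "'a::metric_space set"
    and n :: nat and A :: "nat \<Rightarrow> 'a set"
    and m :: nat and E :: "nat \<Rightarrow> 'a set"
    and \<tau> :: "nat \<Rightarrow> 'a \<Rightarrow> 'a" and \<rho> :: "nat \<Rightarrow> real"
  assumes cantor: "cantor_set C"
    and model_clopen: "\<And>j. j < n \<Longrightarrow> clopen_in C (A j)"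
    and model_nonempty: "\<And>j. j < n \<Longrightarrow> A j \<noteq> {}"
    and model_disjoint: "disjoint_family_on A {..<n}"
    and model_cover: "(\<Union>j<n. A j) = C"
    and clone_clopen: "\<And>i. i < m \<Longrightarrow> clopen_in C (E i)"
    and clone_nonempty: "\<And>i. i < m \<Longrightarrow> E i \<noteq> {}"
    and clone_disjoint: "disjoint_family_on E {..<m}"
    and clone_cover: "(\<Union>i<m. E i) = C"
    and clone_in_model: "\<And>i. i < m \<Longrightarrow> \<exists>j<n. E i \<subseteq> A j"
    and model_two_clones:
      "\<And>j. j < n \<Longrightarrow> \<exists>i<m. \<exists>i'<m. i \<noteq> i' \<and> E i \<subseteq> A j \<and> E i' \<subseteq> A j"
    and clone_map: "\<And>i. i < m \<Longrightarrow> \<exists>j<n. similarity_map (E i) (A j) (\<tau> i) (\<rho> i)"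
    and scale_gt_1: "\<And>i. i < m \<Longrightarrow> \<rho> i > 1"

text \<open>The clone \<open>E k\<close> is of type \<open>i\<close> iff \<open>\<tau> k ` E k = A i\<close>.\<close>

definition clone_matrix ::
    "nat \<Rightarrow> (nat \<Rightarrow> 'a set) \<Rightarrow> nat \<Rightarrow> (nat \<Rightarrow> 'a set) \<Rightarrow> (nat \<Rightarrow> 'a \<Rightarrow> 'a) \<Rightarrow> (nat \<Rightarrow> real)
     \<Rightarrow> real \<Rightarrow> real mat" where
  "clone_matrix n A m E \<tau> \<rho> d =
     mat n n (\<lambda>(i, j).
       \<Sum>k | k < m \<and> \<tau> k ` E k = A i \<and> E k \<subseteq> A j. inverse (\<rho> k) powr d)"

definition irreducible_matrix :: "real mat \<Rightarrow> bool" where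
  "irreducible_matrix M \<longleftrightarrow>
     square_mat M \<and>
     (\<forall>i<dim_row M. \<forall>j<dim_row M. M $$ (i, j) \<ge> 0) \<and>
     (\<exists>k>0. \<forall>i<dim_row M. \<forall>j<dim_row M. (M ^\<^sub>m k) $$ (i, j) > 0)"

text \<open>Which entries of a power of \<open>clone_matrix \<dots> d\<close> are positive does not depend on \<open>d\<close>, so
  \<open>\<exists>d>0\<close> and \<open>\<forall>d>0\<close> are equivalent here.\<close>

definition has_irreducible_matrix ::
    "nat \<Rightarrow> (nat \<Rightarrow> 'a set) \<Rightarrow> nat \<Rightarrow> (nat \<Rightarrow> 'a set) \<Rightarrow> (nat \<Rightarrow> 'a \<Rightarrow> 'a) \<Rightarrow> (nat \<Rightarrow> real)
     \<Rightarrow> bool" where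
  "has_irreducible_matrix n A m E \<tau> \<rho> \<longleftrightarrow>
     (\<exists>d>0. irreducible_matrix (clone_matrix n A m E \<tau> \<rho> d))"

subsection \<open>The clopen invariant\<close>

definition similar_sets :: "real set \<Rightarrow> real set \<Rightarrow> bool" where
  "similar_sets S T \<longleftrightarrow>
     (\<exists>\<alpha> \<beta>. \<alpha> \<noteq> 0 \<and> \<beta> \<noteq> 0 \<and> (\<lambda>x. \<alpha> * x) ` S \<subseteq> T \<and> (\<lambda>x. \<beta> * x) ` T \<subseteq> S)"

text \<open>The measures of the clopens in \<open>X\<close>, a model of \<open>C\<close>, in the dimension of \<open>C\<close>. For a
  multi-model Cantor set with irreducible matrix, the dimension and these measures are finite.\<close>

definition clopen_measures :: "'a::metric_space set \<Rightarrow> 'a set \<Rightarrow> real set" where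
  "clopen_measures C X =
     {enn2real (hausdorff_measure (enn2real (hausdorff_dimension C)) U) | U. clopen_in X U}"

definition clopen_invariant :: "'a::metric_space set \<Rightarrow> 'a set \<Rightarrow> real set set" where
  "clopen_invariant C X = {T. similar_sets (clopen_measures C X) T}"

end

theory Submission
  imports Defs
begin

text \<open>The comparison of \<open>\<nu> W = H\<^sub>\<delta> (f W)\<close> with \<open>\<mu> W = H\<^sub>\<delta> W\<close> takes place on clones, the pieces of
  \<open>C\<close> that iterated clone maps enlarge to \<open>C\<close> or to a model. Since \<open>f\<close> is bilipschitz,
  rescaling \<open>f V\<close> by the smallest clone of \<open>C'\<close> containing it yields a clopen separated from its
  complement by a constant independent of \<open>V\<close>, and by compactness there are only finitely many such
  clopens. So the factor by which \<open>\<nu> / \<mu>\<close> changes from a clone to one of its children takes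
  finitely many values. As \<open>\<nu> / \<mu>\<close> is bounded, a clone with ratio close enough to the supremum has
  no child of larger ratio, whence all its descendants, and therefore all clopens in it, have the
  same ratio. On it \<open>f\<close> multiplies the measure by a constant, and irreducibility puts similar copies
  of every model inside every non-empty clopen.

  By irreducibility the measures of the non-empty clopens are either all \<open>0\<close>, or all \<open>\<infinity>\<close>, or all positive and finite, and a
  bilipschitz map preserves the case. In the first two both invariants are the class of \<open>{0}\<close>,
  because \<open>enn2real \<infinity> = 0\<close>.\<close>

subsection \<open>Separated subsets\<close>

text \<open>A clopen of a compact set in quantitative form. The constant can be followed through
  similarities and bilipschitz maps, and on a compact set a fixed positive constant leaves only
  finitely many sets.\<close>

definition separated_in :: "real \<Rightarrow> 'a::metric_space set \<Rightarrow> 'a set \<Rightarrow> bool" where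
  "separated_in \<eta> X U \<longleftrightarrow> U \<subseteq> X \<and> (\<forall>p\<in>U. \<forall>q\<in>X - U. \<eta> \<le> dist p q)"

lemma separated_inD: "separated_in \<eta> X U \<Longrightarrow> p \<in> U \<Longrightarrow> q \<in> X \<Longrightarrow> q \<notin> U \<Longrightarrow> \<eta> \<le> dist p q"
  by (simp add: separated_in_def)

lemma separated_in_subset: "separated_in \<eta> X U \<Longrightarrow> U \<subseteq> X"
  by (simp add: separated_in_def)

lemma separated_in_self: "separated_in \<eta> X X"
  by (simp add: separated_in_def)

lemma separated_in_weaken: "separated_in \<eta> X U \<Longrightarrow> \<theta> \<le> \<eta> \<Longrightarrow> separated_in \<theta> X U"
  by (force simp: separated_in_def)

lemma separated_in_Diff: "separated_in \<eta> X U \<Longrightarrow> separated_in \<eta> X (X - U)"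
  unfolding separated_in_def by (metis Diff_iff Diff_subset dist_commute)

lemma separated_in_Int_subset:
  "separated_in \<eta> X U \<Longrightarrow> Y \<subseteq> X \<Longrightarrow> separated_in \<eta> Y (Y \<inter> U)"
  unfolding separated_in_def by blast

lemma separated_in_trans:
  assumes "separated_in \<eta> X U" "separated_in \<theta> U W" "\<kappa> \<le> \<eta>" "\<kappa> \<le> \<theta>"
  shows "separated_in \<kappa> X W"
proof -
  have "\<kappa> \<le> dist p q" if "p \<in> W" "q \<in> X" "q \<notin> W" for p q
  proof (cases "q \<in> U")
    case True
    then show ?thesis using separated_inD[OF assms(2) that(1) True that(3)] assms(4) by linarith
  next
    case False
    have "p \<in> U" using that(1) separated_in_subset[OF assms(2)] by blast
    then show ?thesis using separated_inD[OF assms(1) _ that(2) False] assms(3) by force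
  qed
  moreover have "W \<subseteq> X" using assms(1,2) separated_in_subset by blast
  ultimately show ?thesis by (simp add: separated_in_def)
qed

lemma separated_in_image:
  assumes "separated_in \<eta> X U" and "l \<ge> 0"
    and "\<And>x y. x \<in> X \<Longrightarrow> y \<in> X \<Longrightarrow> l * dist x y \<le> dist (f x) (f y)"
  shows "separated_in (l * \<eta>) (f ` X) (f ` U)"
proof -
  have "l * \<eta> \<le> dist (f p) (f q)" if "p \<in> U" "q \<in> X" "q \<notin> U" for p q
  proof -
    have "l * \<eta> \<le> l * dist p q"
      using assms(1,2) that by (intro mult_left_mono separated_inD)
    also have "\<dots> \<le> dist (f p) (f q)"
      using assms(1,3) that separated_in_subset by blast
    finally show ?thesis .
  qed
  then show ?thesis
    using assms(1) unfolding separated_in_def by blast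
qed

lemma separated_in_vimage:
  assumes "separated_in \<eta> Y U" and "L > 0" and "f ` X \<subseteq> Y"
    and "\<And>x y. x \<in> X \<Longrightarrow> y \<in> X \<Longrightarrow> dist (f x) (f y) \<le> L * dist x y"
  shows "separated_in (\<eta> / L) X (X \<inter> f -` U)"
proof -
  have "\<eta> / L \<le> dist p q" if "p \<in> X" "f p \<in> U" "q \<in> X" "f q \<notin> U" for p q
  proof -
    have "\<eta> \<le> dist (f p) (f q)"
      using assms(1,3) that by (auto intro: separated_inD)
    then show ?thesis
      using assms(2) assms(4)[OF that(1,3)] by (simp add: field_simps)
  qed
  then show ?thesis by (auto simp: separated_in_def)
qed

section \<open>Clopens of a compact set and separated subsets\<close>

lemma separated_in_imp_clopen_in:
  assumes "separated_in \<eta> X U" "\<eta> > 0" shows "clopen_in X U"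
proof -
  have op: "openin (top_of_set X) W" if "separated_in \<eta> X W" for W
  proof -
    have "\<forall>x\<in>W. \<exists>e>0. \<forall>y\<in>X. dist y x < e \<longrightarrow> y \<in> W"
      using \<open>\<eta> > 0\<close> separated_inD[OF that] by (metis dist_commute linorder_not_less)
    then show ?thesis
      using separated_in_subset[OF that] by (simp add: openin_euclidean_subtopology_iff)
  qed
  have "openin (top_of_set X) (X - U)"
    using op separated_in_Diff[OF assms(1)] by blast
  then show ?thesis
    using op[OF assms(1)] separated_in_subset[OF assms(1)]
    by (auto simp: clopen_in_def closedin_def)
qed

text \<open>The distance attains a minimum on the compact set \<open>U \<times> (X - U)\<close>, and
  it is positive because the two factors are disjoint.\<close>

lemma clopen_in_imp_separated_in:
  assumes "compact X" "clopen_in X U" obtains \<eta> where "\<eta> > 0" "separated_in \<eta> X U"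
proof -
  have "closedin (top_of_set X) U" "closedin (top_of_set X) (X - U)" "U \<subseteq> X"
    using assms(2) by (auto simp: clopen_in_def dest: openin_imp_subset)
  then have comp: "compact (U \<times> (X - U))"
    using assms(1) by (intro compact_Times) (auto intro: closedin_compact)
  show ?thesis
  proof (cases "U \<times> (X - U) = {}")
    \<comment> \<open>There is no pair to minimise over, so the condition is vacuous and any
      positive constant serves.\<close>
    case True
    then show ?thesis using \<open>U \<subseteq> X\<close> by (intro that[of 1]) (auto simp: separated_in_def)
  next
    case False
    have "continuous_on (U \<times> (X - U)) (\<lambda>z. dist (fst z) (snd z))"
      by (intro continuous_intros)
    then obtain z where z: "z \<in> U \<times> (X - U)"
        "\<forall>w\<in>U \<times> (X - U). dist (fst z) (snd z) \<le> dist (fst w) (snd w)"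
      using continuous_attains_inf[OF comp False] by blast
    have "dist (fst z) (snd z) > 0" using z(1) by auto
    moreover have "separated_in (dist (fst z) (snd z)) X U"
      unfolding separated_in_def using z(2) \<open>U \<subseteq> X\<close> by (metis SigmaI fst_conv snd_conv)
    ultimately show ?thesis by (rule that)
  qed
qed

lemma clopen_in_subset: "clopen_in X U \<Longrightarrow> U \<subseteq> X"
  by (auto simp: clopen_in_def dest: openin_imp_subset)

lemma clopen_in_trans:
  "clopen_in X U \<Longrightarrow> clopen_in U W \<Longrightarrow> clopen_in X W"
  unfolding clopen_in_def by (meson closedin_trans openin_trans)

lemma finite_common_separation:
  assumes "finite F" "compact X" "\<And>U. U \<in> F \<Longrightarrow> clopen_in X U"
  obtains \<eta> where "\<eta> > 0" "\<And>U. U \<in> F \<Longrightarrow> separated_in \<eta> X U"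
proof -
  have "\<exists>\<eta>>0. \<forall>U\<in>F. separated_in \<eta> X U"
    using assms
  proof (induction F)
    case empty
    show ?case by (intro exI[of _ 1]) simp
  next
    case (insert U F)
    then obtain \<eta> where "\<eta> > 0" "\<forall>U\<in>F. separated_in \<eta> X U" by auto
    moreover obtain \<theta> where "\<theta> > 0" "separated_in \<theta> X U"
      using clopen_in_imp_separated_in[OF insert.prems(1,2)] by blast
    ultimately show ?case
      by (intro exI[of _ "min \<eta> \<theta>"]) (auto intro: separated_in_weaken)
  qed
  then show ?thesis using that by blast
qed

text \<open>A \<open>\<eta>\<close>-separated set is the union of the balls it meets in a fixed finite cover by
  balls of radius \<open>\<eta>/2\<close>.\<close>

lemma finite_separated_subsets:
  assumes "compact X" "\<eta> > 0"
  shows "finite {U. separated_in \<eta> X U}"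
proof -
  have "X \<subseteq> (\<Union>c\<in>X. ball c (\<eta> / 2))" using assms(2) by auto
  from compactE_image[OF assms(1) _ this]
  obtain F where F: "finite F" "X \<subseteq> (\<Union>c\<in>F. ball c (\<eta> / 2))"
    by (metis open_ball)
  have "U \<in> (\<lambda>G. X \<inter> (\<Union>c\<in>G. ball c (\<eta> / 2))) ` Pow F" if U: "separated_in \<eta> X U" for U
  proof -
    define G where "G = {c \<in> F. ball c (\<eta> / 2) \<inter> U \<noteq> {}}"
    have "U = X \<inter> (\<Union>c\<in>G. ball c (\<eta> / 2))"
    proof (intro subset_antisym subsetI)
      fix x assume "x \<in> U"
      moreover from this obtain c where "c \<in> F" "x \<in> ball c (\<eta> / 2)"
        using F(2) separated_in_subset[OF U] by blast
      ultimately show "x \<in> X \<inter> (\<Union>c\<in>G. ball c (\<eta> / 2))"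
        using separated_in_subset[OF U] unfolding G_def by blast
    next
      fix x assume "x \<in> X \<inter> (\<Union>c\<in>G. ball c (\<eta> / 2))"
      then obtain c y where "x \<in> X" "dist c x < \<eta> / 2" "y \<in> U" "dist c y < \<eta> / 2"
        by (auto simp: G_def)
      then have "dist y x < \<eta>"
        by (blast intro: dist_triangle_half_r)
      with \<open>x \<in> X\<close> \<open>y \<in> U\<close> show "x \<in> U"
        using separated_inD[OF U] by force
    qed
    moreover have "G \<in> Pow F" by (auto simp: G_def)
    ultimately show ?thesis by blast
  qed
  then have "{U. separated_in \<eta> X U} \<subseteq> (\<lambda>G. X \<inter> (\<Union>c\<in>G. ball c (\<eta> / 2))) ` Pow F" by blast
  then show ?thesis
    by (rule finite_subset) (simp add: F(1))
qed

subsection \<open>Hausdorff measure\<close>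

lemma diam_power_empty [simp]: "diam_power s {} = 0"
  by (simp add: diam_power_def)

lemma diam_power_mono:
  assumes "s \<ge> 0" "V \<subseteq> W" "bounded W" shows "diam_power s V \<le> diam_power s W"
  using assms diameter_subset[of V W] diameter_ge_0[of V] bounded_subset[of W V]
  by (auto simp: diam_power_def intro!: ennreal_leI powr_mono2)

lemma hausdorff_premeasure_le:
  assumes "X \<subseteq> (\<Union>i. V i)" "\<And>i. bounded (V i)" "\<And>i. diameter (V i) \<le> \<epsilon>"
  shows "hausdorff_premeasure s \<epsilon> X \<le> (\<Sum>i. diam_power s (V i))"
  unfolding hausdorff_premeasure_def using assms by (intro INF_lower) auto

lemma hausdorff_premeasure_greatest:
  assumes "\<And>V. X \<subseteq> (\<Union>i. V i) \<Longrightarrow> (\<And>i. bounded (V i)) \<Longrightarrow> (\<And>i. diameter (V i) \<le> \<epsilon>)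
    \<Longrightarrow> c \<le> (\<Sum>i::nat. diam_power s (V i))"
  shows "c \<le> hausdorff_premeasure s \<epsilon> X"
  unfolding hausdorff_premeasure_def using assms by (intro INF_greatest) auto

lemma hausdorff_premeasure_le_measure:
  "\<epsilon> > 0 \<Longrightarrow> hausdorff_premeasure s \<epsilon> X \<le> hausdorff_measure s X"
  unfolding hausdorff_measure_def by (intro SUP_upper) auto

lemma hausdorff_measure_least:
  "(\<And>\<epsilon>. \<epsilon> > 0 \<Longrightarrow> hausdorff_premeasure s \<epsilon> X \<le> c) \<Longrightarrow> hausdorff_measure s X \<le> c"
  unfolding hausdorff_measure_def by (intro SUP_least) auto

lemma hausdorff_premeasure_antimono:
  assumes "\<epsilon> \<le> \<epsilon>'" shows "hausdorff_premeasure s \<epsilon>' X \<le> hausdorff_premeasure s \<epsilon> X"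
  using assms by (intro hausdorff_premeasure_greatest hausdorff_premeasure_le) (auto intro: order_trans)

lemma hausdorff_measure_mono:
  assumes "X \<subseteq> Y" shows "hausdorff_measure s X \<le> hausdorff_measure s Y"
proof (rule hausdorff_measure_least)
  fix \<epsilon> :: real assume "\<epsilon> > 0"
  have "hausdorff_premeasure s \<epsilon> X \<le> hausdorff_premeasure s \<epsilon> Y"
    using assms by (intro hausdorff_premeasure_greatest hausdorff_premeasure_le) auto
  also have "\<dots> \<le> hausdorff_measure s Y"
    using \<open>\<epsilon> > 0\<close> by (rule hausdorff_premeasure_le_measure)
  finally show "hausdorff_premeasure s \<epsilon> X \<le> hausdorff_measure s Y" .
qed

lemma hausdorff_measure_empty [simp]: "hausdorff_measure s {} = 0"
proof -
  have "hausdorff_measure s ({} :: 'a set) \<le> 0"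
  proof (rule hausdorff_measure_least)
    fix \<epsilon> :: real assume "\<epsilon> > 0"
    then show "hausdorff_premeasure s \<epsilon> ({} :: 'a set) \<le> 0"
      using hausdorff_premeasure_le[of "{} :: 'a set" "\<lambda>_. {}" \<epsilon> s] by simp
  qed
  then show ?thesis by simp
qed

section \<open>Hausdorff measure under Lipschitz maps and similarities\<close>

lemma hausdorff_measure_lipschitz_image:
  fixes f :: "'a::metric_space \<Rightarrow> 'b::metric_space"
  assumes "L > 0" "s \<ge> 0"
    and f: "\<And>x y. x \<in> X \<Longrightarrow> y \<in> X \<Longrightarrow> dist (f x) (f y) \<le> L * dist x y"
  shows "hausdorff_measure s (f ` X) \<le> ennreal (L powr s) * hausdorff_measure s X"
proof (rule hausdorff_measure_least)
  fix \<epsilon> :: real assume "\<epsilon> > 0"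
  \<comment> \<open>A cover of \<open>X\<close> yields a cover of its image by the images of the
    traces \<open>X \<inter> V i\<close>. Traces are taken because \<open>f\<close> is controlled on
    \<open>X\<close> only; diameters grow at most by the factor \<open>L\<close>.\<close>
  have *: "hausdorff_premeasure s \<epsilon> (f ` X) \<le> ennreal (L powr s) * (\<Sum>i. diam_power s (V i))"
    if V: "X \<subseteq> (\<Union>i. V i)" "\<And>i. bounded (V i)" "\<And>i. diameter (V i) \<le> \<epsilon> / L"
    for V :: "nat \<Rightarrow> 'a set"
  proof -
    have d: "dist x y \<le> L * diameter (V i)"
      if xy: "x \<in> f ` (X \<inter> V i)" "y \<in> f ` (X \<inter> V i)" for x y i
    proof -
      obtain u v where uv: "u \<in> X \<inter> V i" "v \<in> X \<inter> V i" "x = f u" "y = f v"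
        using xy by auto
      then have "dist x y \<le> L * dist u v" using f by auto
      also have "\<dots> \<le> L * diameter (V i)"
        using uv V(2)[of i] \<open>L > 0\<close> by (intro mult_left_mono diameter_bounded_bound) auto
      finally show ?thesis .
    qed
    have bd: "bounded (f ` (X \<inter> V i))" for i
      using d[of _ i] unfolding bounded_two_points by blast
    have diam: "diameter (f ` (X \<inter> V i)) \<le> L * diameter (V i)" for i
      using d[of _ i] \<open>L > 0\<close> diameter_ge_0[OF V(2), of i]
      by (auto simp: diameter_def[of "f ` (X \<inter> V i)"] intro!: cSUP_least)
    have dp: "diam_power s (f ` (X \<inter> V i)) \<le> ennreal (L powr s) * diam_power s (V i)" for i
    proof (cases "f ` (X \<inter> V i) = {} \<or> s = 0")
      case True
      then show ?thesis using \<open>L > 0\<close> by (auto simp: diam_power_def)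
    next
      case False
      have "diameter (f ` (X \<inter> V i)) powr s \<le> (L * diameter (V i)) powr s"
        using diam[of i] diameter_ge_0[OF bd, of i] assms(2) by (intro powr_mono2) auto
      also have "\<dots> = L powr s * diameter (V i) powr s"
        by (rule powr_mult)
      finally show ?thesis
        using False by (auto simp: diam_power_def ennreal_mult'[symmetric] ennreal_leI)
    qed
    have "f ` X \<subseteq> (\<Union>i. f ` (X \<inter> V i))" using V(1) by blast
    moreover have "diameter (f ` (X \<inter> V i)) \<le> \<epsilon>" for i
      using diam[of i] V(3)[of i] \<open>L > 0\<close> by (simp add: field_simps)
    ultimately have "hausdorff_premeasure s \<epsilon> (f ` X) \<le> (\<Sum>i. diam_power s (f ` (X \<inter> V i)))"
      using bd by (intro hausdorff_premeasure_le) auto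
    also have "\<dots> \<le> (\<Sum>i. ennreal (L powr s) * diam_power s (V i))"
      using dp by (intro suminf_le) auto
    finally show ?thesis by (simp add: ennreal_suminf_cmult)
  qed
  have L: "ennreal (L powr s) > 0" "ennreal (L powr s) \<noteq> \<infinity>" using \<open>L > 0\<close> by auto
  \<comment> \<open>The bound holds for each cover, so the factor is moved to the left before the
    infimum over covers is taken. It is positive and finite, hence can be restored
    afterwards.\<close>
  have "hausdorff_premeasure s \<epsilon> (f ` X) / ennreal (L powr s) \<le> hausdorff_premeasure s (\<epsilon> / L) X"
  proof (rule hausdorff_premeasure_greatest)
    fix V :: "nat \<Rightarrow> 'a set"
    assume "X \<subseteq> (\<Union>i. V i)" "\<And>i. bounded (V i)" "\<And>i. diameter (V i) \<le> \<epsilon> / L"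
    from *[OF this] L(1)
    show "hausdorff_premeasure s \<epsilon> (f ` X) / ennreal (L powr s) \<le> (\<Sum>i. diam_power s (V i))"
      by (intro divide_le_posI_ennreal) (auto simp: mult.commute)
  qed
  also have "\<dots> \<le> hausdorff_measure s X"
    using \<open>\<epsilon> > 0\<close> \<open>L > 0\<close> by (intro hausdorff_premeasure_le_measure) auto
  finally have "ennreal (L powr s) * (hausdorff_premeasure s \<epsilon> (f ` X) / ennreal (L powr s))
      \<le> ennreal (L powr s) * hausdorff_measure s X"
    by (rule mult_left_mono) simp
  also have "ennreal (L powr s) * (hausdorff_premeasure s \<epsilon> (f ` X) / ennreal (L powr s))
      = hausdorff_premeasure s \<epsilon> (f ` X)"
    using L by (simp add: ennreal_times_divide mult.commute[of "ennreal (L powr s)"]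
        ennreal_mult_divide_eq infinity_ennreal_def)
  finally show "hausdorff_premeasure s \<epsilon> (f ` X) \<le> ennreal (L powr s) * hausdorff_measure s X" .
qed

text \<open>The Lipschitz bound applies to \<open>f\<close> with constant \<open>r\<close> and to
  its inverse with \<open>1 / r\<close>, and the two factors cancel.\<close>

lemma hausdorff_measure_similarity:
  assumes f: "similarity_map X Y f r" and "s \<ge> 0"
  shows "hausdorff_measure s Y = ennreal (r powr s) * hausdorff_measure s X"
proof (rule antisym)
  have r: "r > 0" "f ` X = Y" "\<And>x y. x \<in> X \<Longrightarrow> y \<in> X \<Longrightarrow> dist (f x) (f y) = r * dist x y"
    using f by (auto simp: similarity_map_def)
  show "hausdorff_measure s Y \<le> ennreal (r powr s) * hausdorff_measure s X"
    using hausdorff_measure_lipschitz_image[of r s X f] r \<open>s \<ge> 0\<close> by auto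
  have "inj_on f X"
    using r by (metis inj_onI dist_eq_0_iff mult_eq_0_iff less_irrefl)
  then have g: "inv_into X f ` Y = X" using inv_into_image_cancel[of f X X] r(2) by simp
  have "hausdorff_measure s (inv_into X f ` Y) \<le> ennreal ((1 / r) powr s) * hausdorff_measure s Y"
  proof (rule hausdorff_measure_lipschitz_image)
    fix x y assume "x \<in> Y" "y \<in> Y"
    then show "dist (inv_into X f x) (inv_into X f y) \<le> 1 / r * dist x y"
      using r(3)[of "inv_into X f x" "inv_into X f y"] r(1,2)
      by (auto simp: f_inv_into_f inv_into_into)
  qed (use r \<open>s \<ge> 0\<close> in auto)
  then have "ennreal (r powr s) * hausdorff_measure s X
      \<le> ennreal (r powr s) * (ennreal ((1 / r) powr s) * hausdorff_measure s Y)"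
    unfolding g by (rule mult_left_mono) simp
  also have "\<dots> = hausdorff_measure s Y"
    using r(1) by (simp add: mult.assoc[symmetric] ennreal_mult'[symmetric] powr_mult[symmetric])
  finally show "ennreal (r powr s) * hausdorff_measure s X \<le> hausdorff_measure s Y" .
qed

section \<open>Subadditivity, and additivity on separated pieces\<close>

lemma suminf_interleave_le:
  fixes f g :: "nat \<Rightarrow> ennreal"
  shows "(\<Sum>i. if even i then f (i div 2) else g (i div 2)) \<le> (\<Sum>i. f i) + (\<Sum>i. g i)"
proof -
  define h where "h i = (if even i then f (i div 2) else g (i div 2))" for i
  have h: "(\<Sum>i<2 * N. h i) = (\<Sum>i<N. f i) + (\<Sum>i<N. g i)" for N
    by (induction N) (auto simp: h_def algebra_simps)
  have "(\<Sum>i<N. h i) \<le> (\<Sum>i. f i) + (\<Sum>i. g i)" for N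
  proof -
    have "(\<Sum>i<N. h i) \<le> (\<Sum>i<2 * N. h i)" by (rule sum_mono2) auto
    also have "\<dots> \<le> (\<Sum>i. f i) + (\<Sum>i. g i)"
      unfolding h by (intro add_mono sum_le_suminf) auto
    finally show ?thesis .
  qed
  then show ?thesis
    unfolding h_def by (intro suminf_le_const) auto
qed

text \<open>Two covers are interleaved into one sequence, which makes the premeasures subadditive at
  each scale.\<close>

lemma hausdorff_measure_Un_le:
  fixes X Y :: "'a::metric_space set"
  shows "hausdorff_measure s (X \<union> Y) \<le> hausdorff_measure s X + hausdorff_measure s Y"
proof (rule hausdorff_measure_least)
  fix \<epsilon> :: real assume "\<epsilon> > 0"
  let ?p = "hausdorff_premeasure s \<epsilon>"
  have *: "?p (X \<union> Y) \<le> (\<Sum>i. diam_power s (V i)) + (\<Sum>i. diam_power s (W i))"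
    if V: "X \<subseteq> (\<Union>i. V i)" "\<And>i. bounded (V i)" "\<And>i. diameter (V i) \<le> \<epsilon>"
      and W: "Y \<subseteq> (\<Union>i. W i)" "\<And>i. bounded (W i)" "\<And>i. diameter (W i) \<le> \<epsilon>"
    for V W :: "nat \<Rightarrow> 'a set"
  proof -
    define Z where "Z i = (if even i then V (i div 2) else W (i div 2))" for i
    have "V i \<subseteq> (\<Union>i. Z i)" for i
      using UN_upper[of "2 * i" UNIV Z] by (simp add: Z_def)
    moreover have "W i \<subseteq> (\<Union>i. Z i)" for i
      using UN_upper[of "2 * i + 1" UNIV Z] by (simp add: Z_def)
    ultimately have "X \<union> Y \<subseteq> (\<Union>i. Z i)"
      by (meson UN_least Un_least V(1) W(1) order_trans)
    then have "?p (X \<union> Y) \<le> (\<Sum>i. diam_power s (Z i))"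
      by (rule hausdorff_premeasure_le) (simp_all add: Z_def V W)
    also have "\<dots> = (\<Sum>i. if even i then diam_power s (V (i div 2)) else diam_power s (W (i div 2)))"
      by (intro suminf_cong) (auto simp: Z_def)
    also note suminf_interleave_le
    finally show ?thesis .
  qed
  \<comment> \<open>Infima are taken over one cover at a time, after subtracting the other term. In
    \<open>ennreal\<close> this calls for a finite subtrahend; if it is infinite, the claim is
    trivial.\<close>
  have **: "?p (X \<union> Y) \<le> (\<Sum>i. diam_power s (W i)) + ?p X" (is "_ \<le> ?w + _")
    if W: "Y \<subseteq> (\<Union>i. W i)" "\<And>i. bounded (W i)" "\<And>i. diameter (W i) \<le> \<epsilon>"
    for W :: "nat \<Rightarrow> 'a set"
  proof (cases "?w = \<infinity>")
    case False
    have "?p (X \<union> Y) - ?w \<le> ?p X"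
    proof (rule hausdorff_premeasure_greatest)
      fix V :: "nat \<Rightarrow> 'a set"
      assume "X \<subseteq> (\<Union>i. V i)" "\<And>i. bounded (V i)" "\<And>i. diameter (V i) \<le> \<epsilon>"
      from *[OF this W] False show "?p (X \<union> Y) - ?w \<le> (\<Sum>i. diam_power s (V i))"
        by (simp add: ennreal_minus_le_iff add.commute infinity_ennreal_def)
    qed
    then show ?thesis by (simp add: ennreal_minus_le_iff)
  qed (simp add: infinity_ennreal_def)
  have "?p (X \<union> Y) \<le> ?p X + ?p Y"
  proof (cases "?p X = \<infinity>")
    case False
    have "?p (X \<union> Y) - ?p X \<le> ?p Y"
    proof (rule hausdorff_premeasure_greatest)
      fix W :: "nat \<Rightarrow> 'a set"
      assume "Y \<subseteq> (\<Union>i. W i)" "\<And>i. bounded (W i)" "\<And>i. diameter (W i) \<le> \<epsilon>"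
      from **[OF this] False show "?p (X \<union> Y) - ?p X \<le> (\<Sum>i. diam_power s (W i))"
        by (simp add: ennreal_minus_le_iff add.commute infinity_ennreal_def)
    qed
    then show ?thesis by (simp add: ennreal_minus_le_iff)
  qed (simp add: infinity_ennreal_def)
  also have "\<dots> \<le> hausdorff_measure s X + hausdorff_measure s Y"
    using \<open>\<epsilon> > 0\<close> by (intro add_mono hausdorff_premeasure_le_measure)
  finally show "?p (X \<union> Y) \<le> hausdorff_measure s X + hausdorff_measure s Y" .
qed

text \<open>A set of diameter below \<open>\<eta>\<close> cannot meet both \<open>U\<close> and
  \<open>X - U\<close>. So every fine cover of \<open>X\<close> splits into covers of
  \<open>U\<close> and of \<open>X - U\<close> without raising the sum.\<close>

lemma hausdorff_measure_separated_split:
  fixes X U :: "'a::metric_space set"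
  assumes U: "separated_in \<eta> X U" and "\<eta> > 0" "s \<ge> 0"
  shows "hausdorff_measure s X = hausdorff_measure s U + hausdorff_measure s (X - U)"
proof (rule antisym)
  have "X = U \<union> (X - U)" using separated_in_subset[OF U] by auto
  then show "hausdorff_measure s X \<le> hausdorff_measure s U + hausdorff_measure s (X - U)"
    using hausdorff_measure_Un_le by metis
  have small: "hausdorff_premeasure s \<epsilon> U + hausdorff_premeasure s \<epsilon> (X - U)
      \<le> hausdorff_premeasure s \<epsilon> X" if \<epsilon>: "\<epsilon> > 0" "\<epsilon> < \<eta>" for \<epsilon>
  proof (rule hausdorff_premeasure_greatest)
    fix V :: "nat \<Rightarrow> 'a set"
    assume V: "X \<subseteq> (\<Union>i. V i)" "\<And>i. bounded (V i)" "\<And>i. diameter (V i) \<le> \<epsilon>"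
    have 1: "hausdorff_premeasure s \<epsilon> W \<le> (\<Sum>i. diam_power s (V i \<inter> W))" if "W \<subseteq> X" for W
    proof (rule hausdorff_premeasure_le)
      show "W \<subseteq> (\<Union>i. V i \<inter> W)" using V(1) that by auto
      show "bounded (V i \<inter> W)" for i by (rule bounded_subset[OF V(2) Int_lower1])
      show "diameter (V i \<inter> W) \<le> \<epsilon>" for i
        using diameter_subset[OF Int_lower1 V(2)] V(3) by (rule order_trans)
    qed
    have 2: "diam_power s (V i \<inter> U) + diam_power s (V i \<inter> (X - U)) \<le> diam_power s (V i)" for i
    proof -
      have "V i \<inter> U = {} \<or> V i \<inter> (X - U) = {}"
      proof (rule ccontr)
        assume "\<not> ?thesis"
        then obtain p q where "p \<in> V i" "p \<in> U" "q \<in> V i" "q \<in> X" "q \<notin> U" by auto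
        then have "\<eta> \<le> dist p q" "dist p q \<le> diameter (V i)"
          using separated_inD[OF U] diameter_bounded_bound[OF V(2)] by auto
        then show False using V(3)[of i] \<epsilon> by simp
      qed
      \<comment> \<open>One trace is empty and contributes \<open>0\<close>, even for
        \<open>s = 0\<close>, by the convention in \<open>diam_power\<close>.\<close>
      then show ?thesis
        using diam_power_mono[OF \<open>s \<ge> 0\<close> Int_lower1 V(2)] by auto
    qed
    have "hausdorff_premeasure s \<epsilon> U + hausdorff_premeasure s \<epsilon> (X - U)
        \<le> (\<Sum>i. diam_power s (V i \<inter> U)) + (\<Sum>i. diam_power s (V i \<inter> (X - U)))"
      using separated_in_subset[OF U] by (intro add_mono 1) auto
    also have "\<dots> = (\<Sum>i. diam_power s (V i \<inter> U) + diam_power s (V i \<inter> (X - U)))"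
      by (rule suminf_add) auto
    also have "\<dots> \<le> (\<Sum>i. diam_power s (V i))"
      using 2 by (intro suminf_le) auto
    finally show "hausdorff_premeasure s \<epsilon> U + hausdorff_premeasure s \<epsilon> (X - U)
      \<le> (\<Sum>i. diam_power s (V i))" .
  qed
  \<comment> \<open>The two suprema run over independent scales. Premeasures grow as the scale
    shrinks, so both are bounded at a common scale below \<open>\<eta>\<close>.\<close>
  have *: "hausdorff_premeasure s \<epsilon> U + hausdorff_premeasure s \<epsilon>' (X - U)
      \<le> hausdorff_measure s X" if \<epsilon>: "\<epsilon> > 0" "\<epsilon>' > 0" for \<epsilon> \<epsilon>'
  proof -
    define e where "e = min (min \<epsilon> \<epsilon>') (\<eta> / 2)"
    have e: "e > 0" "e < \<eta>" "e \<le> \<epsilon>" "e \<le> \<epsilon>'" using \<epsilon> \<open>\<eta> > 0\<close> by (auto simp: e_def)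
    have "hausdorff_premeasure s \<epsilon> U + hausdorff_premeasure s \<epsilon>' (X - U)
      \<le> hausdorff_premeasure s e U + hausdorff_premeasure s e (X - U)"
      using e by (intro add_mono hausdorff_premeasure_antimono)
    also note small[OF e(1,2)]
    also note hausdorff_premeasure_le_measure[OF e(1)]
    finally show ?thesis .
  qed
  have "hausdorff_measure s U + hausdorff_premeasure s \<epsilon> (X - U) \<le> hausdorff_measure s X"
    if "\<epsilon> > 0" for \<epsilon>
    unfolding hausdorff_measure_def[of s U]
    by (subst ennreal_SUP_add_left[symmetric]) (use * that in \<open>auto intro!: SUP_least\<close>)
  then show "hausdorff_measure s U + hausdorff_measure s (X - U) \<le> hausdorff_measure s X"
    unfolding hausdorff_measure_def[of s "X - U"]
    by (subst ennreal_SUP_add_right) (auto intro!: SUP_least)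
qed

lemma hausdorff_measure_UN_separated:
  assumes "finite I" and sep: "\<And>i. i \<in> I \<Longrightarrow> separated_in \<eta> X (U i)" and "\<eta> > 0" "s \<ge> 0"
    and disj: "disjoint_family_on U I"
  shows "hausdorff_measure s (\<Union>i\<in>I. U i) = (\<Sum>i\<in>I. hausdorff_measure s (U i))"
  using assms(1,2) disj
proof (induction I)
  case empty
  then show ?case by simp
next
  case (insert i I)
  have d: "U i \<inter> (\<Union>i\<in>I. U i) = {}"
    using insert by (auto simp: disjoint_family_on_def)
  let ?W = "\<Union>k\<in>insert i I. U k"
  have "?W \<subseteq> X" using insert.prems(1) separated_in_subset by blast
  then have "separated_in \<eta> ?W (?W \<inter> U i)"
    using insert.prems(1) by (intro separated_in_Int_subset) auto
  then have "separated_in \<eta> ?W (U i)" by (simp add: Int_absorb1)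
  moreover have "?W - U i = (\<Union>i\<in>I. U i)" using d by auto
  ultimately have "hausdorff_measure s ?W = hausdorff_measure s (U i) + hausdorff_measure s (\<Union>i\<in>I. U i)"
    using hausdorff_measure_separated_split[of \<eta> ?W "U i" s] \<open>\<eta> > 0\<close> \<open>s \<ge> 0\<close> by simp
  moreover have "disjoint_family_on U I"
    using insert.prems(2) by (auto simp: disjoint_family_on_def)
  ultimately show ?case
    using insert by simp
qed

lemma hausdorff_measure_UN_le:
  "finite I \<Longrightarrow> hausdorff_measure s (\<Union>i\<in>I. U i) \<le> (\<Sum>i\<in>I. hausdorff_measure s (U i))"
proof (induction I rule: finite_induct)
  case (insert i I)
  have "hausdorff_measure s (U i \<union> (\<Union>k\<in>I. U k))
      \<le> hausdorff_measure s (U i) + hausdorff_measure s (\<Union>k\<in>I. U k)"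
    by (rule hausdorff_measure_Un_le)
  also have "\<dots> \<le> hausdorff_measure s (U i) + (\<Sum>k\<in>I. hausdorff_measure s (U k))"
    by (rule add_left_mono) (rule insert)
  finally show ?case using insert by simp
qed simp

subsection \<open>Clones\<close>

lemma similarity_map_compose:
  assumes "similarity_map X Y f r" "similarity_map Y Z g s"
  shows "similarity_map X Z (g \<circ> f) (s * r)"
  using assms by (auto simp: similarity_map_def image_comp[symmetric])

lemma similarity_map_vimage:
  assumes "similarity_map X Y f r" "W \<subseteq> Y"
  shows "similarity_map (X \<inter> f -` W) W f r"
  using assms unfolding similarity_map_def by blast

lemma similarity_map_id: "similarity_map X X id 1"
  by (simp add: similarity_map_def)

lemma similarity_map_continuous_on:
  assumes "similarity_map X Y f r" shows "continuous_on X f"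
  unfolding continuous_on_iff
proof (intro ballI allI impI)
  fix x and e :: real assume x: "x \<in> X" and e: "e > 0"
  have r: "r > 0" and d: "\<forall>x\<in>X. \<forall>y\<in>X. dist (f x) (f y) = r * dist x y"
    using assms by (auto simp: similarity_map_def)
  show "\<exists>d>0. \<forall>x'\<in>X. dist x' x < d \<longrightarrow> dist (f x') (f x) < e"
    using x e r d by (intro exI[of _ "e / r"]) (auto simp: field_simps)
qed

lemma clopen_in_similarity_vimage:
  assumes "similarity_map X Y f r" "clopen_in Y W"
  shows "clopen_in X (X \<inter> f -` W)"
proof -
  have "f \<in> X \<rightarrow> Y" using assms(1) by (auto simp: similarity_map_def)
  then show ?thesis
    using assms(2) similarity_map_continuous_on[OF assms(1)] unfolding clopen_in_def
    by (auto intro: continuous_openin_preimage continuous_closedin_preimage_gen)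
qed

lemma clopen_in_subset_iff:
  assumes "clopen_in X Y" "W \<subseteq> Y" shows "clopen_in Y W \<longleftrightarrow> clopen_in X W"
proof
  show "clopen_in Y W \<Longrightarrow> clopen_in X W" using clopen_in_trans[OF assms(1)] .
  assume "clopen_in X W"
  then show "clopen_in Y W"
    using assms clopen_in_subset[OF assms(1)] unfolding clopen_in_def
    by (metis openin_subset_trans closedin_subset_trans)
qed

lemma clopen_in_Int: "clopen_in X U \<Longrightarrow> clopen_in X W \<Longrightarrow> clopen_in X (U \<inter> W)"
  by (auto simp: clopen_in_def)

lemma clopen_in_self: "clopen_in X X"
  by (simp add: clopen_in_def)

lemma clopen_in_empty: "clopen_in X {}"
  by (simp add: clopen_in_def)

text \<open>Irreducibility enters the geometry through this relation only. The scale of the copy is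
  left open, since it just changes measures by a positive factor.\<close>

definition has_clopen_copy :: "'a::metric_space set \<Rightarrow> 'a set \<Rightarrow> bool" where
  "has_clopen_copy X Y \<longleftrightarrow> (\<exists>V \<phi> r. clopen_in X V \<and> similarity_map V Y \<phi> r)"

lemma has_clopen_copy_trans:
  assumes "has_clopen_copy X Y" "has_clopen_copy Y Z" shows "has_clopen_copy X Z"
proof -
  obtain V \<phi> r W \<psi> s where *: "clopen_in X V" "similarity_map V Y \<phi> r"
    "clopen_in Y W" "similarity_map W Z \<psi> s"
    using assms unfolding has_clopen_copy_def by blast
  have "clopen_in X (V \<inter> \<phi> -` W)"
    using * clopen_in_similarity_vimage clopen_in_trans by blast
  moreover have "similarity_map (V \<inter> \<phi> -` W) Z (\<psi> \<circ> \<phi>) (s * r)"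
    using similarity_map_vimage[OF *(2) clopen_in_subset[OF *(3)]] *(4)
    by (rule similarity_map_compose)
  ultimately show ?thesis unfolding has_clopen_copy_def by blast
qed

lemma has_clopen_copy_refl: "has_clopen_copy X X"
  unfolding has_clopen_copy_def using clopen_in_self similarity_map_id by blast

section \<open>The tree of clones\<close>

context multi_model_cantor_set
begin

lemma compact_C: "compact C" and C_nonempty: "C \<noteq> {}" and C_perfect: "x \<in> C \<Longrightarrow> x islimpt C"
  using cantor by (auto simp: cantor_set_def)

lemma m_pos: "m > 0"
  using clone_cover C_nonempty by (cases m) auto

lemma model_subset: "j < n \<Longrightarrow> A j \<subseteq> C" and clone_subset: "i < m \<Longrightarrow> E i \<subseteq> C"
  using model_cover clone_cover by blast+

lemma clone_map_image:
  assumes "i < m" obtains j where "j < n" "\<tau> i ` E i = A j" "similarity_map (E i) (A j) (\<tau> i) (\<rho> i)"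
  using clone_map[OF assms] that by (auto simp: similarity_map_def)

text \<open>A node consists of the clone, the composite of clone maps that enlarges it, its scale
  factor and its depth. The root is all of \<open>C\<close>, so the enlarged clone is
  \<open>C\<close> at depth \<open>0\<close> and a model at every greater depth.\<close>

inductive clone :: "'a set \<Rightarrow> ('a \<Rightarrow> 'a) \<Rightarrow> real \<Rightarrow> nat \<Rightarrow> bool" where
  root: "clone C id 1 0"
| child: "clone V \<phi> r k \<Longrightarrow> i < m \<Longrightarrow> E i \<subseteq> \<phi> ` V
    \<Longrightarrow> clone (V \<inter> \<phi> -` E i) (\<tau> i \<circ> \<phi>) (\<rho> i * r) (Suc k)"

lemma child_image:
  assumes "i < m" "E i \<subseteq> \<phi> ` V"
  shows "(\<tau> i \<circ> \<phi>) ` (V \<inter> \<phi> -` E i) = \<tau> i ` E i"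
proof -
  have "\<phi> ` (V \<inter> \<phi> -` E i) = E i" using assms(2) by blast
  then show ?thesis by (metis image_comp)
qed

lemma clone_image_model: "clone V \<phi> r (Suc k) \<Longrightarrow> \<exists>j<n. \<phi> ` V = A j"
proof (erule clone.cases)
  fix W \<psi> s k i assume "V = W \<inter> \<psi> -` E i" "\<phi> = \<tau> i \<circ> \<psi>" "i < m" "E i \<subseteq> \<psi> ` W"
  then show ?thesis using child_image clone_map_image by metis
qed simp

lemma clone_image:
  assumes "clone V \<phi> r k" shows "\<phi> ` V = C \<or> (\<exists>j<n. \<phi> ` V = A j)"
proof (cases k)
  case 0
  with assms have "V = C" "\<phi> = id" by (auto elim: clone.cases)
  then show ?thesis by simp
next
  case (Suc l)
  then show ?thesis using assms clone_image_model by blast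
qed

lemma clone_image_subset: "clone V \<phi> r k \<Longrightarrow> \<phi> ` V \<subseteq> C"
  using clone_image model_subset by blast

lemma clone_similarity: "clone V \<phi> r k \<Longrightarrow> similarity_map V (\<phi> ` V) \<phi> r"
proof (induction rule: clone.induct)
  case root
  show ?case using similarity_map_id[of C] by (metis image_id id_apply)
next
  case (child V \<phi> r k i)
  obtain j where j: "\<tau> i ` E i = A j" "similarity_map (E i) (A j) (\<tau> i) (\<rho> i)"
    using clone_map_image[OF child.hyps(2)] by metis
  have "similarity_map (V \<inter> \<phi> -` E i) (A j) (\<tau> i \<circ> \<phi>) (\<rho> i * r)"
    using similarity_map_vimage[OF child.IH child.hyps(3)] j(2) by (rule similarity_map_compose)
  then show ?case unfolding child_image[OF child.hyps(2,3)] j(1) .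
qed

lemma clone_dist: "clone V \<phi> r k \<Longrightarrow> x \<in> V \<Longrightarrow> y \<in> V \<Longrightarrow> dist (\<phi> x) (\<phi> y) = r * dist x y"
  using clone_similarity by (auto simp: similarity_map_def)

lemma clone_scale: "clone V \<phi> r k \<Longrightarrow> r > 0"
  using clone_similarity by (auto simp: similarity_map_def)

lemma clone_in_C: "clone V \<phi> r k \<Longrightarrow> V \<subseteq> C"
  by (induction rule: clone.induct) auto

lemma clone_ne: "clone V \<phi> r k \<Longrightarrow> V \<noteq> {}"
proof (induction rule: clone.induct)
  case root
  then show ?case by (rule C_nonempty)
next
  case (child V \<phi> r k i)
  then show ?case using clone_nonempty[OF child.hyps(2)] by blast
qed

text \<open>The smallest of the finitely many scale factors is greater than \<open>1\<close> and
  serves as \<open>q\<close>. Geometric growth of the scales makes deep clones small.\<close>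

lemma clone_scale_bound: "\<exists>q>1. \<forall>V \<phi> r k. clone V \<phi> r k \<longrightarrow> q ^ k \<le> r"
proof -
  define q where "q = Min (\<rho> ` {..<m})"
  have q: "q > 1" "\<And>i. i < m \<Longrightarrow> q \<le> \<rho> i"
  proof -
    have "\<rho> ` {..<m} \<noteq> {}" using m_pos by (simp add: lessThan_empty_iff)
    then show "q > 1" using scale_gt_1 by (auto simp: q_def Min_gr_iff)
    show "\<And>i. i < m \<Longrightarrow> q \<le> \<rho> i" by (auto simp: q_def)
  qed
  have "q ^ k \<le> r" if "clone V \<phi> r k" for V \<phi> r k
    using that
  proof (induction rule: clone.induct)
    case (child V \<phi> r k i)
    have "q * q ^ k \<le> \<rho> i * r"
      using child q(1) q(2)[OF child.hyps(2)] by (intro mult_mono) auto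
    then show ?case by simp
  qed simp
  then show ?thesis using q(1) by blast
qed

lemma clone_scale_ge_1: "clone V \<phi> r k \<Longrightarrow> r \<ge> 1"
proof -
  assume V: "clone V \<phi> r k"
  obtain q where "q > 1" "q ^ k \<le> r"
    using clone_scale_bound V by blast
  then show "r \<ge> 1" using one_le_power[of q k] by linarith
qed

definition children :: "'a set \<Rightarrow> nat set" where
  "children Y = {i. i < m \<and> E i \<subseteq> Y}"

lemma finite_children [simp]: "finite (children Y)"
  by (simp add: children_def)

text \<open>The level-1 clone containing \<open>y\<close> lies in a single model, which by
  disjointness is the enlarged clone unless that is all of \<open>C\<close>.\<close>

lemma clone_image_cover:
  assumes "clone V \<phi> r k" "y \<in> \<phi> ` V" shows "\<exists>i\<in>children (\<phi> ` V). y \<in> E i"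
proof -
  have "y \<in> C" using assms clone_image_subset by blast
  then obtain i where i: "i < m" "y \<in> E i" using clone_cover by blast
  have "E i \<subseteq> \<phi> ` V"
    using clone_image[OF assms(1)]
  proof
    assume "\<phi> ` V = C"
    then show ?thesis using clone_subset i by auto
  next
    assume "\<exists>j<n. \<phi> ` V = A j"
    then obtain j where j: "j < n" "\<phi> ` V = A j" by blast
    obtain j' where j': "j' < n" "E i \<subseteq> A j'" using clone_in_model i(1) by blast
    have "y \<in> A j \<inter> A j'" using i(2) j(2) j'(2) assms(2) by blast
    then have "j = j'"
      using disjoint_family_onD[OF model_disjoint, of j j'] j(1) j'(1) by blast
    then show ?thesis using j j' by simp
  qed
  then show ?thesis using i by (auto simp: children_def)
qed

lemma clone_children_cover:
  assumes "clone V \<phi> r k" shows "V = (\<Union>i\<in>children (\<phi> ` V). V \<inter> \<phi> -` E i)"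
  using clone_image_cover[OF assms] by fast

lemma children_disjoint: "disjoint_family_on (\<lambda>i. V \<inter> \<phi> -` E i) (children Y)"
proof (unfold disjoint_family_on_def, intro ballI impI)
  fix i j assume "i \<in> children Y" "j \<in> children Y" "i \<noteq> j"
  then have "E i \<inter> E j = {}"
    using disjoint_family_onD[OF clone_disjoint, of i j] by (simp add: children_def)
  then show "V \<inter> \<phi> -` E i \<inter> (V \<inter> \<phi> -` E j) = {}" by blast
qed

lemma clone_child:
  "clone V \<phi> r k \<Longrightarrow> i \<in> children (\<phi> ` V)
    \<Longrightarrow> clone (V \<inter> \<phi> -` E i) (\<tau> i \<circ> \<phi>) (\<rho> i * r) (Suc k)"
  by (auto simp: children_def intro: child)

lemma clone_at:
  assumes "x \<in> C" shows "\<exists>V \<phi> r. clone V \<phi> r k \<and> x \<in> V"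
proof (induction k)
  case 0
  then show ?case using root assms by blast
next
  case (Suc k)
  then obtain V \<phi> r where V: "clone V \<phi> r k" "x \<in> V" by blast
  then obtain i where "i \<in> children (\<phi> ` V)" "\<phi> x \<in> E i" using clone_image_cover by blast
  then show ?case using clone_child[OF V(1)] V(2) by blast
qed

section \<open>Separation and size of clones\<close>

definition gap :: real where
  "gap = (SOME \<eta>. \<eta> > 0 \<and> (\<forall>i<m. separated_in \<eta> C (E i)) \<and> (\<forall>j<n. separated_in \<eta> C (A j)))"

text \<open>Finitely many clopens of the compact set \<open>C\<close> admit a common separation, so
  one constant serves all level-1 clones and models.\<close>

lemma gap_pos: "gap > 0" and gap_clone: "\<And>i. i < m \<Longrightarrow> separated_in gap C (E i)"
  and gap_model: "\<And>j. j < n \<Longrightarrow> separated_in gap C (A j)"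
proof -
  have "\<exists>\<eta>>0. (\<forall>i<m. separated_in \<eta> C (E i)) \<and> (\<forall>j<n. separated_in \<eta> C (A j))"
  proof (rule finite_common_separation[of "E ` {..<m} \<union> A ` {..<n}" C])
    fix \<eta> :: real
    assume "\<eta> > 0" "\<And>U. U \<in> E ` {..<m} \<union> A ` {..<n} \<Longrightarrow> separated_in \<eta> C U"
    then show ?thesis by (intro exI[of _ \<eta>]) auto
  qed (auto simp: compact_C clone_clopen model_clopen)
  then have "gap > 0 \<and> (\<forall>i<m. separated_in gap C (E i)) \<and> (\<forall>j<n. separated_in gap C (A j))"
    unfolding gap_def by (rule someI_ex)
  then show "gap > 0" "\<And>i. i < m \<Longrightarrow> separated_in gap C (E i)"
    "\<And>j. j < n \<Longrightarrow> separated_in gap C (A j)" by auto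
qed

lemma clone_image_separated: "clone V \<phi> r k \<Longrightarrow> separated_in gap C (\<phi> ` V)"
  using clone_image gap_model separated_in_self[of gap C] by fastforce

lemma child_separated:
  assumes "clone V \<phi> r k" "i < m" "E i \<subseteq> \<phi> ` V"
  shows "separated_in (gap / r) V (V \<inter> \<phi> -` E i)"
proof (rule separated_in_vimage)
  show "separated_in gap C (E i)" using gap_clone assms by simp
  show "r > 0" using clone_scale assms by blast
  show "\<phi> ` V \<subseteq> C" using clone_image_subset assms by blast
  show "\<And>x y. x \<in> V \<Longrightarrow> y \<in> V \<Longrightarrow> dist (\<phi> x) (\<phi> y) \<le> r * dist x y"
    using clone_dist assms by simp
qed

text \<open>Induction down the tree: a child is separated within its parent by
  \<open>gap / r\<close>, the parent within \<open>C\<close> by the same amount, and the larger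
  scale of the child only lowers the required constant.\<close>

lemma clone_separated: "clone V \<phi> r k \<Longrightarrow> separated_in (gap / r) C V"
proof (induction rule: clone.induct)
  case root
  then show ?case by (rule separated_in_self)
next
  case (child V \<phi> r k i)
  have "gap / (\<rho> i * r) \<le> gap / r"
    using gap_pos scale_gt_1[of i] clone_scale[OF child.hyps(1)] child.hyps(2)
    by (intro divide_left_mono) auto
  then show ?case
    using separated_in_trans[OF child.IH child_separated[OF child.hyps]] by simp
qed

lemma clone_clopen_in: "clone V \<phi> r k \<Longrightarrow> clopen_in C V"
  using separated_in_imp_clopen_in[OF clone_separated] clone_scale gap_pos by simp

lemma clone_diameter:
  assumes "clone V \<phi> r k" "x \<in> V" "y \<in> V" shows "r * dist x y \<le> diameter C"
proof -
  have "dist (\<phi> x) (\<phi> y) \<le> diameter C"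
    using clone_image_subset[OF assms(1)] assms(2,3) compact_C
    by (intro diameter_bounded_bound compact_imp_bounded) auto
  then show ?thesis using clone_dist[OF assms] by simp
qed

text \<open>An enlarged clone stays inside \<open>C\<close>, so a clone of scale \<open>r\<close>
  has diameter at most \<open>diameter C / r\<close>, and \<open>r\<close> grows geometrically with
  the depth.\<close>

lemma small_clones:
  assumes "\<epsilon> > 0"
  shows "\<exists>N. \<forall>V \<phi> r k. clone V \<phi> r k \<longrightarrow> k \<ge> N \<longrightarrow> (\<forall>x\<in>V. \<forall>y\<in>V. dist x y < \<epsilon>)"
proof -
  obtain q where q: "q > 1" "\<And>V \<phi> r k. clone V \<phi> r k \<Longrightarrow> q ^ k \<le> r"
    using clone_scale_bound by blast
  obtain N where N: "diameter C / \<epsilon> < q ^ N" using real_arch_pow[OF q(1)] by blast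
  have "dist x y < \<epsilon>" if V: "clone V \<phi> r k" "k \<ge> N" "x \<in> V" "y \<in> V" for V \<phi> r k x y
  proof (rule ccontr)
    assume "\<not> dist x y < \<epsilon>"
    moreover have "q ^ N \<le> r"
      using power_increasing[OF V(2), of q] q(1) q(2)[OF V(1)] by linarith
    ultimately have "q ^ N * \<epsilon> \<le> r * dist x y"
      using clone_scale[OF V(1)] assms by (intro mult_mono) auto
    then show False
      using clone_diameter[OF V(1,3,4)] N assms by (simp add: field_simps)
  qed
  then show ?thesis by blast
qed

text \<open>A clone smaller than the separation of \<open>U\<close> cannot leave \<open>U\<close>.
  The depth is positive so that the enlarged clone is a model.\<close>

lemma clopen_contains_clone:
  assumes "clopen_in C U" "x \<in> U"
  obtains V \<phi> r k where "clone V \<phi> r (Suc k)" "x \<in> V" "V \<subseteq> U"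
proof -
  obtain \<epsilon> where \<epsilon>: "\<epsilon> > 0" "separated_in \<epsilon> C U"
    using clopen_in_imp_separated_in[OF compact_C assms(1)] .
  obtain N where N: "\<forall>V \<phi> r k. clone V \<phi> r k \<longrightarrow> k \<ge> N \<longrightarrow> (\<forall>x\<in>V. \<forall>y\<in>V. dist x y < \<epsilon>)"
    using small_clones[OF \<epsilon>(1)] by blast
  have "x \<in> C" using assms clopen_in_subset by blast
  then obtain V \<phi> r where V: "clone V \<phi> r (Suc N)" "x \<in> V" using clone_at by blast
  have "V \<subseteq> U"
  proof
    fix y assume "y \<in> V"
    then have "dist x y < \<epsilon>" "y \<in> C" using N V clone_in_C le_SucI by blast+
    then show "y \<in> U" using separated_inD[OF \<epsilon>(2) assms(2)] by force
  qed
  then show ?thesis using that V by blast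
qed

text \<open>\<open>C\<close> is perfect, and a point of \<open>C\<close> closer to \<open>x\<close>
  than the separation of the clone belongs to the clone. The two points make
  \<open>smallest_clone\<close> applicable to images of clones.\<close>

lemma clone_two_points:
  assumes "clone V \<phi> r k" obtains x y where "x \<in> V" "y \<in> V" "x \<noteq> y"
proof -
  obtain x where x: "x \<in> V" using clone_ne[OF assms] by blast
  then have "x islimpt C" using clone_in_C[OF assms] C_perfect by blast
  then obtain y where y: "y \<in> C" "y \<noteq> x" "dist y x < gap / r"
    using gap_pos clone_scale[OF assms] unfolding islimpt_approachable
    by (meson divide_pos_pos)
  then have "y \<in> V"
    using separated_inD[OF clone_separated[OF assms] x] by (metis dist_commute not_le)
  then show ?thesis using that x y by blast
qed

text \<open>The smallest clone containing a given set has size comparable to the diameter of that set.\<close>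

lemma smallest_clone:
  assumes "X \<subseteq> C" "x0 \<in> X" "y0 \<in> X" "x0 \<noteq> y0"
  obtains V \<phi> r k x y where "clone V \<phi> r k" "X \<subseteq> V" "x \<in> X" "y \<in> X" "gap \<le> r * dist x y"
proof -
  \<comment> \<open>The depths of clones containing \<open>X\<close> are bounded, since deep clones
    are too small to contain both \<open>x0\<close> and \<open>y0\<close>. A clone of greatest depth
    is chosen.\<close>
  define Q where "Q k \<longleftrightarrow> (\<exists>V \<phi> r. clone V \<phi> r k \<and> X \<subseteq> V)" for k
  obtain N where N: "\<forall>V \<phi> r k. clone V \<phi> r k \<longrightarrow> k \<ge> N
      \<longrightarrow> (\<forall>x\<in>V. \<forall>y\<in>V. dist x y < dist x0 y0)"
    using small_clones[of "dist x0 y0"] assms(4) zero_less_dist_iff by blast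
  have "Q 0" using root assms(1) by (auto simp: Q_def)
  moreover have bound: "k \<le> N" if Q: "Q k" for k
  proof (rule ccontr)
    assume "\<not> k \<le> N"
    moreover obtain V \<phi> r where "clone V \<phi> r k" "X \<subseteq> V" using Q by (auto simp: Q_def)
    ultimately have "dist x0 y0 < dist x0 y0" using N assms(2,3) by (meson nat_le_linear subsetD)
    then show False by simp
  qed
  ultimately obtain k where k: "Q k" "\<And>l. Q l \<Longrightarrow> l \<le> k"
    using Nat.ex_has_greatest_nat[of Q 0 N] by blast
  then obtain V \<phi> r where V: "clone V \<phi> r k" "X \<subseteq> V" by (auto simp: Q_def)
  have "\<phi> x0 \<in> \<phi> ` V" using assms V by blast
  then obtain i where i: "i \<in> children (\<phi> ` V)" "\<phi> x0 \<in> E i"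
    using clone_image_cover[OF V(1)] by blast
  \<comment> \<open>By maximality \<open>X\<close> does not fit into the child containing
    \<open>x0\<close>. A point of \<open>X\<close> outside that child is at distance at least
    \<open>gap\<close> from \<open>x0\<close> after enlargement.\<close>
  have "\<not> X \<subseteq> V \<inter> \<phi> -` E i"
  proof
    assume "X \<subseteq> V \<inter> \<phi> -` E i"
    then have "Q (Suc k)" using clone_child[OF V(1) i(1)] unfolding Q_def by blast
    then show False using k(2) by fastforce
  qed
  then obtain y where y: "y \<in> X" "\<phi> y \<notin> E i" using V(2) by blast
  have "separated_in gap C (E i)" using i(1) gap_clone by (simp add: children_def)
  moreover have "\<phi> y \<in> C" using clone_image_subset[OF V(1)] V(2) y(1) by blast
  ultimately have "gap \<le> dist (\<phi> x0) (\<phi> y)"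
    using i(2) y(2) separated_inD by blast
  also have "\<dots> = r * dist x0 y" using clone_dist[OF V(1)] V(2) assms(2) y(1) by blast
  finally show ?thesis using that V assms(2) y(1) by blast
qed

section \<open>Powers of the clone matrix\<close>

lemma clone_matrix_carrier: "clone_matrix n A m E \<tau> \<rho> d \<in> carrier_mat n n"
  by (simp add: clone_matrix_def)

lemma clone_matrix_nonneg:
  "i < n \<Longrightarrow> j < n \<Longrightarrow> clone_matrix n A m E \<tau> \<rho> d $$ (i, j) \<ge> 0"
  by (auto simp: clone_matrix_def intro!: sum_nonneg)

lemma clone_matrix_pos_copy:
  assumes "i < n" "j < n" "clone_matrix n A m E \<tau> \<rho> d $$ (i, j) > 0"
  shows "has_clopen_copy (A j) (A i)"
proof -
  have "{k. k < m \<and> \<tau> k ` E k = A i \<and> E k \<subseteq> A j} \<noteq> {}"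
  proof
    assume none: "{k. k < m \<and> \<tau> k ` E k = A i \<and> E k \<subseteq> A j} = {}"
    have "clone_matrix n A m E \<tau> \<rho> d $$ (i, j)
        = (\<Sum>k | k < m \<and> \<tau> k ` E k = A i \<and> E k \<subseteq> A j. inverse (\<rho> k) powr d)"
      using assms(1,2) by (simp add: clone_matrix_def)
    also have "\<dots> = 0" unfolding none by simp
    finally show False using assms(3) by simp
  qed
  then obtain k where k: "k < m" "\<tau> k ` E k = A i" "E k \<subseteq> A j" by blast
  have "similarity_map (E k) (A i) (\<tau> k) (\<rho> k)"
    using clone_map_image[OF k(1)] k(2) by metis
  moreover have "clopen_in (A j) (E k)"
    using clopen_in_subset_iff[OF model_clopen k(3)] clone_clopen k(1) assms(2) by blast
  ultimately show ?thesis unfolding has_clopen_copy_def by blast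
qed

text \<open>A positive entry of a product has a positive term, whose two factors give copies that
  compose. Non-negativity is carried through the induction so that a non-zero term has positive
  factors.\<close>

lemma clone_matrix_power_pos_copy:
  fixes d :: real
  defines "M \<equiv> clone_matrix n A m E \<tau> \<rho> d"
  shows "i < n \<Longrightarrow> j < n \<Longrightarrow>
    (M ^\<^sub>m k) $$ (i, j) \<ge> 0 \<and> ((M ^\<^sub>m k) $$ (i, j) > 0 \<longrightarrow> has_clopen_copy (A j) (A i))"
proof (induction k arbitrary: i j)
  case 0
  then show ?case
    using clone_matrix_carrier[of d] has_clopen_copy_refl by (auto simp: M_def)
next
  case (Suc k)
  have M: "M \<in> carrier_mat n n" "M ^\<^sub>m k \<in> carrier_mat n n"
    using clone_matrix_carrier[of d] by (auto simp: M_def)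
  have eq: "(M ^\<^sub>m Suc k) $$ (i, j) = (\<Sum>l\<in>{0..<n}. (M ^\<^sub>m k) $$ (i, l) * M $$ (l, j))"
    using M Suc.prems by (simp add: scalar_prod_def)
  have nonneg: "0 \<le> (M ^\<^sub>m k) $$ (i, l) * M $$ (l, j)" if "l < n" for l
    using Suc.IH[OF Suc.prems(1) that] clone_matrix_nonneg[OF that Suc.prems(2)]
    by (auto simp: M_def)
  have "has_clopen_copy (A j) (A i)" if pos: "(M ^\<^sub>m Suc k) $$ (i, j) > 0"
  proof -
    obtain l where l: "l < n" "(M ^\<^sub>m k) $$ (i, l) * M $$ (l, j) \<noteq> 0"
      using pos unfolding eq by (metis (no_types, lifting) atLeastLessThan_iff less_irrefl sum.neutral)
    have "(M ^\<^sub>m k) $$ (i, l) > 0" "M $$ (l, j) > 0"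
      using l(2) Suc.IH[OF Suc.prems(1) l(1)] clone_matrix_nonneg[OF l(1) Suc.prems(2), of d]
      by (auto simp: M_def less_le)
    then show ?thesis
      using has_clopen_copy_trans Suc.IH[OF Suc.prems(1) l(1)] clone_matrix_pos_copy l(1) Suc.prems(2)
      unfolding M_def by blast
  qed
  moreover have "(M ^\<^sub>m Suc k) $$ (i, j) \<ge> 0"
    unfolding eq using nonneg by (intro sum_nonneg) auto
  ultimately show ?case by blast
qed

end

section \<open>Consequences of irreducibility\<close>

locale irreducible_cantor_set = multi_model_cantor_set +
  assumes irreducible: "has_irreducible_matrix n A m E \<tau> \<rho>"
begin

lemma model_copy:
  assumes "i < n" "j < n" shows "has_clopen_copy (A j) (A i)"
proof -
  obtain d k where "\<forall>i<n. \<forall>j<n. (clone_matrix n A m E \<tau> \<rho> d ^\<^sub>m k) $$ (i, j) > 0"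
    using irreducible carrier_matD(1)[OF clone_matrix_carrier]
    by (auto simp: has_irreducible_matrix_def irreducible_matrix_def)
  then show ?thesis using clone_matrix_power_pos_copy[OF assms] assms by blast
qed

text \<open>\<open>U\<close> contains a clone whose enlargement is some model \<open>A i\<close>,
  and \<open>A i\<close> contains a copy of \<open>A j\<close>.\<close>

lemma clopen_has_model_copy:
  assumes "clopen_in C U" "U \<noteq> {}" "j < n" shows "has_clopen_copy U (A j)"
proof -
  obtain x where "x \<in> U" using assms(2) by blast
  then obtain V \<phi> r k where V: "clone V \<phi> r (Suc k)" "V \<subseteq> U"
    using clopen_contains_clone[OF assms(1)] by metis
  obtain i where i: "i < n" "\<phi> ` V = A i" using clone_image_model[OF V(1)] by blast
  have "clopen_in U V" using clopen_in_subset_iff[OF assms(1) V(2)] clone_clopen_in[OF V(1)] by blast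
  then have "has_clopen_copy U (A i)"
    using clone_similarity[OF V(1)] i unfolding has_clopen_copy_def by metis
  then show ?thesis using model_copy[OF assms(3) i(1)] by (rule has_clopen_copy_trans)
qed

lemma hausdorff_measure_model_le:
  assumes "clopen_in C U" "U \<noteq> {}" "j < n" "s \<ge> 0"
  obtains c where "c > 0" "hausdorff_measure s (A j) \<le> ennreal c * hausdorff_measure s U"
proof -
  obtain V \<phi> r where V: "clopen_in U V" "similarity_map V (A j) \<phi> r"
    using clopen_has_model_copy[OF assms(1-3)] by (auto simp: has_clopen_copy_def)
  have "hausdorff_measure s (A j) = ennreal (r powr s) * hausdorff_measure s V"
    using hausdorff_measure_similarity V(2) assms(4) .
  also have "\<dots> \<le> ennreal (r powr s) * hausdorff_measure s U"
    using clopen_in_subset[OF V(1)] by (intro mult_left_mono hausdorff_measure_mono) auto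
  finally show ?thesis
    using that[of "r powr s"] V(2) by (simp add: similarity_map_def)
qed

lemma hausdorff_measure_C_le:
  "hausdorff_measure s C \<le> (\<Sum>j<n. hausdorff_measure s (A j))"
  using hausdorff_measure_UN_le[of "{..<n}" s A] model_cover by simp

text \<open>Each model is a rescaled copy of a clopen in \<open>U\<close>, and \<open>C\<close> is a
  finite union of models, so a null \<open>U\<close> forces \<open>C\<close> to be null.\<close>

lemma hausdorff_measure_clopen_zero_iff:
  assumes "clopen_in C U" "U \<noteq> {}" "s \<ge> 0"
  shows "hausdorff_measure s U = 0 \<longleftrightarrow> hausdorff_measure s C = 0"
proof
  assume U: "hausdorff_measure s U = 0"
  have "hausdorff_measure s (A j) = 0" if j: "j < n" for j
    using hausdorff_measure_model_le[OF assms(1,2) j assms(3)] U by (metis le_zero_eq mult_zero_right)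
  then show "hausdorff_measure s C = 0"
    using hausdorff_measure_C_le[of s] by simp
next
  assume "hausdorff_measure s C = 0"
  then show "hausdorff_measure s U = 0"
    using hausdorff_measure_mono[OF clopen_in_subset[OF assms(1)], of s] by simp
qed

lemma hausdorff_measure_clopen_infinite_iff:
  assumes "clopen_in C U" "U \<noteq> {}" "s \<ge> 0"
  shows "hausdorff_measure s U = \<infinity> \<longleftrightarrow> hausdorff_measure s C = \<infinity>"
proof
  assume C: "hausdorff_measure s C = \<infinity>"
  show "hausdorff_measure s U = \<infinity>"
  proof (rule ccontr)
    assume U: "hausdorff_measure s U \<noteq> \<infinity>"
    have "hausdorff_measure s (A j) < \<infinity>" if j: "j < n" for j
    proof -
      obtain c where "hausdorff_measure s (A j) \<le> ennreal c * hausdorff_measure s U"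
        using hausdorff_measure_model_le[OF assms(1,2) j assms(3)] by metis
      also have "\<dots> < \<infinity>"
        using U by (simp add: ennreal_mult_less_top less_top infinity_ennreal_def)
      finally show ?thesis .
    qed
    then have "(\<Sum>j<n. hausdorff_measure s (A j)) < \<infinity>"
      by (simp add: infinity_ennreal_def)
    then have "hausdorff_measure s C < \<infinity>"
      using hausdorff_measure_C_le by (rule le_less_trans[rotated])
    then show False using C by simp
  qed
next
  assume "hausdorff_measure s U = \<infinity>"
  then show "hausdorff_measure s C = \<infinity>"
    using hausdorff_measure_mono[OF clopen_in_subset[OF assms(1)], of s]
    by (simp add: infinity_ennreal_def top_unique)
qed

end

subsection \<open>The ratio of the measures of a clone and its image\<close>

text \<open>The invariant consists of reals. Since \<open>enn2real\<close> sends
  \<open>\<infinity>\<close> to \<open>0\<close>, the value agrees with the measure only when that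
  is finite.\<close>

definition real_hausdorff_measure :: "real \<Rightarrow> 'a::metric_space set \<Rightarrow> real" where
  "real_hausdorff_measure s X = enn2real (hausdorff_measure s X)"

lemma real_hausdorff_measure_empty [simp]: "real_hausdorff_measure s {} = 0"
  by (simp add: real_hausdorff_measure_def)

lemma real_hausdorff_measure_similarity:
  "similarity_map X Y f r \<Longrightarrow> s \<ge> 0
    \<Longrightarrow> real_hausdorff_measure s Y = r powr s * real_hausdorff_measure s X"
  using hausdorff_measure_similarity[of X Y f r s]
  by (simp add: real_hausdorff_measure_def enn2real_mult)

text \<open>What the argument uses of \<open>s\<close> is that the total measure is positive and
  finite; \<open>clopen_invariant_eq\<close> later takes \<open>s\<close> to be the Hausdorff
  dimension.\<close>

locale irreducible_cantor_set_measure = irreducible_cantor_set +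
  fixes s :: real
  assumes s_nonneg: "s \<ge> 0"
    and measure_nonzero: "hausdorff_measure s C \<noteq> 0"
    and measure_finite: "hausdorff_measure s C \<noteq> \<infinity>"
begin

lemma clopen_measure_finite: "clopen_in C U \<Longrightarrow> hausdorff_measure s U \<noteq> \<infinity>"
  using hausdorff_measure_clopen_infinite_iff[OF _ _ s_nonneg, of U] measure_finite
  by (cases "U = {}") auto

lemma clopen_measure_pos:
  assumes "clopen_in C U" "U \<noteq> {}" shows "real_hausdorff_measure s U > 0"
  using hausdorff_measure_clopen_zero_iff[OF assms s_nonneg] measure_nonzero
    clopen_measure_finite[OF assms(1)]
  by (auto simp: real_hausdorff_measure_def enn2real_positive_iff infinity_ennreal_def less_top
      zero_less_iff_neq_zero)

lemma clopen_measure_UN: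
  assumes "finite I" "\<And>i. i \<in> I \<Longrightarrow> clopen_in C (U i)" "disjoint_family_on U I"
  shows "real_hausdorff_measure s (\<Union>i\<in>I. U i) = (\<Sum>i\<in>I. real_hausdorff_measure s (U i))"
proof -
  obtain \<eta> where \<eta>: "\<eta> > 0" "\<And>W. W \<in> U ` I \<Longrightarrow> separated_in \<eta> C W"
    using finite_common_separation[of "U ` I" C] assms(1,2) compact_C by blast
  have "hausdorff_measure s (\<Union>i\<in>I. U i) = (\<Sum>i\<in>I. hausdorff_measure s (U i))"
    using \<eta> assms(1,3) s_nonneg by (intro hausdorff_measure_UN_separated[of I \<eta> C]) auto
  then show ?thesis
    using clopen_measure_finite assms(2)
    by (simp add: real_hausdorff_measure_def enn2real_sum less_top infinity_ennreal_def)
qed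

end

section \<open>Transfer of clopens, measures and dimension by the embedding\<close>

locale bilipschitz_embedding =
  X: irreducible_cantor_set C n A m E \<tau> \<rho> + Y: irreducible_cantor_set C' n' A' m' E' \<tau>' \<rho>'
  for C :: "'a::metric_space set" and n A m E \<tau> \<rho>
    and C' :: "'b::metric_space set" and n' A' m' E' \<tau>' \<rho>' +
  fixes f :: "'a \<Rightarrow> 'b" and K :: real
  assumes K_pos: "K > 0"
    and dist_lower: "\<And>x y. x \<in> C \<Longrightarrow> y \<in> C \<Longrightarrow> 1 / K * dist x y \<le> dist (f x) (f y)"
    and dist_upper: "\<And>x y. x \<in> C \<Longrightarrow> y \<in> C \<Longrightarrow> dist (f x) (f y) \<le> K * dist x y"
    and range_clopen: "clopen_in C' (f ` C)"
begin

lemma inj_f: "inj_on f C"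
proof (rule inj_onI)
  fix x y assume "x \<in> C" "y \<in> C" "f x = f y"
  then have "1 / K * dist x y \<le> 0" using dist_lower[of x y] by simp
  then show "x = y" using K_pos by (simp add: divide_le_0_iff)
qed

lemma clopen_in_image:
  assumes "clopen_in C W" shows "clopen_in C' (f ` W)"
proof -
  obtain \<eta> where \<eta>: "\<eta> > 0" "separated_in \<eta> C W"
    using clopen_in_imp_separated_in[OF X.compact_C assms] .
  have "separated_in (1 / K * \<eta>) (f ` C) (f ` W)"
    using K_pos dist_lower by (intro separated_in_image[OF \<eta>(2)]) auto
  then have "clopen_in (f ` C) (f ` W)"
    by (rule separated_in_imp_clopen_in) (use \<eta>(1) K_pos in simp)
  then show ?thesis using clopen_in_trans range_clopen by blast
qed

lemma clopen_in_vimage: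
  assumes "clopen_in C' W" shows "clopen_in C (C \<inter> f -` W)"
proof -
  obtain \<eta> where \<eta>: "\<eta> > 0" "separated_in \<eta> C' W"
    using clopen_in_imp_separated_in[OF Y.compact_C assms] .
  have "separated_in (\<eta> / K) C (C \<inter> f -` W)"
    using K_pos dist_upper clopen_in_subset[OF range_clopen]
    by (intro separated_in_vimage[OF \<eta>(2)]) auto
  then show ?thesis by (rule separated_in_imp_clopen_in) (use \<eta>(1) K_pos in simp)
qed

lemma hausdorff_measure_image_le:
  "W \<subseteq> C \<Longrightarrow> s \<ge> 0 \<Longrightarrow> hausdorff_measure s (f ` W) \<le> ennreal (K powr s) * hausdorff_measure s W"
  using K_pos dist_upper by (intro hausdorff_measure_lipschitz_image) auto

text \<open>The lower distance bound says that the inverse of \<open>f\<close> is Lipschitz with the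
  same constant \<open>K\<close>.\<close>

lemma hausdorff_measure_le_image:
  assumes "W \<subseteq> C" "s \<ge> 0"
  shows "hausdorff_measure s W \<le> ennreal (K powr s) * hausdorff_measure s (f ` W)"
proof -
  have "hausdorff_measure s (inv_into C f ` f ` W) \<le> ennreal (K powr s) * hausdorff_measure s (f ` W)"
  proof (rule hausdorff_measure_lipschitz_image[OF K_pos assms(2)])
    fix x y assume "x \<in> f ` W" "y \<in> f ` W"
    then obtain u v where uv: "u \<in> C" "v \<in> C" "x = f u" "y = f v" using assms(1) by blast
    then show "dist (inv_into C f x) (inv_into C f y) \<le> K * dist x y"
      using dist_lower[OF uv(1,2)] K_pos inj_f by (simp add: field_simps)
  qed
  then show ?thesis using inv_into_image_cancel[OF inj_f assms(1)] by simp
qed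

lemma range_nonempty: "f ` C \<noteq> {}"
  using X.C_nonempty by blast

text \<open>\<open>f\<close> preserves nullity in both directions, and the image of
  \<open>C\<close>, being a non-empty clopen, is null exactly when \<open>C'\<close> is. Equality of
  the dimensions follows.\<close>

lemma measure_zero_iff:
  assumes "s \<ge> 0" shows "hausdorff_measure s C' = 0 \<longleftrightarrow> hausdorff_measure s C = 0"
proof -
  have "hausdorff_measure s (f ` C) = 0 \<longleftrightarrow> hausdorff_measure s C = 0"
    using hausdorff_measure_image_le[OF order_refl assms] hausdorff_measure_le_image[OF order_refl assms]
    by auto
  then show ?thesis
    using Y.hausdorff_measure_clopen_zero_iff[OF range_clopen range_nonempty assms] by simp
qed

lemma measure_infinite_iff:
  assumes "s \<ge> 0" shows "hausdorff_measure s C' = \<infinity> \<longleftrightarrow> hausdorff_measure s C = \<infinity>"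
proof -
  have *: "a = \<infinity> \<Longrightarrow> b = \<infinity>" if "a \<le> ennreal (K powr s) * b" for a b
    using that by (cases b) (auto simp: ennreal_mult[symmetric] infinity_ennreal_def top_unique)
  have "hausdorff_measure s (f ` C) = \<infinity> \<longleftrightarrow> hausdorff_measure s C = \<infinity>"
    using *[OF hausdorff_measure_image_le[OF order_refl assms]]
      *[OF hausdorff_measure_le_image[OF order_refl assms]] by blast
  then show ?thesis
    using Y.hausdorff_measure_clopen_infinite_iff[OF range_clopen range_nonempty assms] by simp
qed

lemma hausdorff_dimension_eq: "hausdorff_dimension C' = hausdorff_dimension C"
proof -
  have "{s. 0 \<le> s \<and> hausdorff_measure s C' = 0} = {s. 0 \<le> s \<and> hausdorff_measure s C = 0}"
    using measure_zero_iff by auto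
  then show ?thesis by (simp only: hausdorff_dimension_def)
qed

end

section \<open>The two measures on the clopens of \<open>C\<close>\<close>

locale bilipschitz_embedding_measure = bilipschitz_embedding +
  fixes s :: real
  assumes s_nonneg': "s \<ge> 0"
    and measure_nonzero': "hausdorff_measure s C \<noteq> 0"
    and measure_finite': "hausdorff_measure s C \<noteq> \<infinity>"
begin

sublocale X: irreducible_cantor_set_measure C n A m E \<tau> \<rho> s
  by unfold_locales (fact s_nonneg' measure_nonzero' measure_finite')+

sublocale Y: irreducible_cantor_set_measure C' n' A' m' E' \<tau>' \<rho>' s
  using measure_zero_iff[OF s_nonneg'] measure_infinite_iff[OF s_nonneg']
  by unfold_locales (simp_all only: s_nonneg' measure_nonzero' measure_finite' not_False_eq_True)

definition \<mu> :: "'a set \<Rightarrow> real" where "\<mu> W = real_hausdorff_measure s W"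
definition \<nu> :: "'a set \<Rightarrow> real" where "\<nu> W = real_hausdorff_measure s (f ` W)"

lemma \<mu>_pos: "clopen_in C W \<Longrightarrow> W \<noteq> {} \<Longrightarrow> \<mu> W > 0"
  using X.clopen_measure_pos by (simp add: \<mu>_def)

lemma \<nu>_pos: "clopen_in C W \<Longrightarrow> W \<noteq> {} \<Longrightarrow> \<nu> W > 0"
  using Y.clopen_measure_pos clopen_in_image by (simp add: \<nu>_def)

lemma \<mu>_empty [simp]: "\<mu> {} = 0" and \<nu>_empty [simp]: "\<nu> {} = 0"
  by (simp_all add: \<mu>_def \<nu>_def)

lemma \<mu>_UN:
  assumes "finite I" "\<And>i. i \<in> I \<Longrightarrow> clopen_in C (U i)" "disjoint_family_on U I"
  shows "\<mu> (\<Union>i\<in>I. U i) = (\<Sum>i\<in>I. \<mu> (U i))"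
  unfolding \<mu>_def using assms by (rule X.clopen_measure_UN)

lemma \<nu>_UN:
  assumes "finite I" "\<And>i. i \<in> I \<Longrightarrow> clopen_in C (U i)" "disjoint_family_on U I"
  shows "\<nu> (\<Union>i\<in>I. U i) = (\<Sum>i\<in>I. \<nu> (U i))"
proof -
  have "disjoint_family_on (\<lambda>i. f ` U i) I"
    unfolding disjoint_family_on_def
  proof (intro ballI impI)
    fix i j assume ij: "i \<in> I" "j \<in> I" "i \<noteq> j"
    then have "f ` U i \<inter> f ` U j = f ` (U i \<inter> U j)"
      using inj_on_image_Int[OF inj_f] assms(2) clopen_in_subset by metis
    then show "f ` U i \<inter> f ` U j = {}"
      using disjoint_family_onD[OF assms(3) ij] by simp
  qed
  then show ?thesis
    unfolding \<nu>_def image_UN using assms(1) clopen_in_image[OF assms(2)]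
    by (intro Y.clopen_measure_UN)
qed

text \<open>Serves to bound the ratios of clones, so that their supremum exists.\<close>

lemma \<nu>_le: "clopen_in C W \<Longrightarrow> \<nu> W \<le> K powr s * \<mu> W"
proof -
  assume W: "clopen_in C W"
  have "ennreal (K powr s) * hausdorff_measure s W < \<infinity>"
    using X.clopen_measure_finite[OF W]
    by (simp add: ennreal_mult_less_top less_top infinity_ennreal_def)
  then show "\<nu> W \<le> K powr s * \<mu> W"
    using enn2real_mono[OF hausdorff_measure_image_le[OF clopen_in_subset[OF W] s_nonneg']]
    by (simp add: \<nu>_def \<mu>_def real_hausdorff_measure_def enn2real_mult infinity_ennreal_def)
qed

section \<open>Zooming in on the images of clones\<close>

definition image_gap :: real where
  "image_gap = (SOME \<eta>. \<eta> > 0 \<and> separated_in \<eta> C' (f ` C))"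

lemma image_gap: "image_gap > 0" "separated_in image_gap C' (f ` C)"
proof -
  have "\<exists>\<eta>>0. separated_in \<eta> C' (f ` C)"
    using clopen_in_imp_separated_in[OF Y.compact_C range_clopen] by blast
  then have "image_gap > 0 \<and> separated_in image_gap C' (f ` C)"
    unfolding image_gap_def by (rule someI_ex)
  then show "image_gap > 0" "separated_in image_gap C' (f ` C)" by auto
qed

lemma diameter_C_pos: "diameter C > 0"
proof -
  obtain x y where "x \<in> C" "y \<in> C" "x \<noteq> y" using X.clone_two_points[OF X.root] .
  then have "0 < dist x y" "dist x y \<le> diameter C"
    using X.clone_diameter[OF X.root] by auto
  then show ?thesis by linarith
qed

text \<open>\<open>P\<close> stands for a bound on the scale factors of the clone maps.
  \<open>Y.gap\<close> separates the enlarged clone in \<open>C'\<close>,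
  \<open>Y.gap / (K * diameter C)\<close> bounds \<open>r' / r\<close> from below, and the inner
  minimum bounds \<open>r\<close> times the separation of the image in \<open>C'\<close>.\<close>

definition zoom_gap :: "real \<Rightarrow> real" where
  "zoom_gap P = min Y.gap (Y.gap / (K * diameter C) * min (X.gap / (P * K)) image_gap)"

lemma zoom_gap_pos: "P > 0 \<Longrightarrow> zoom_gap P > 0"
  using X.gap_pos Y.gap_pos image_gap(1) K_pos diameter_C_pos by (simp add: zoom_gap_def)

text \<open>After rescaling by the smallest clone of \<open>C'\<close> containing \<open>f ` V\<close>, the images of \<open>V\<close> and
  of its children are separated by a constant independent of \<open>V\<close>, hence belong to a finite family.\<close>

lemma zoomed_image_separated:
  assumes V: "X.clone V \<phi> r k"
    and V': "Y.clone V' \<phi>' r' k'" "f ` V \<subseteq> V'"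
    and xy: "x \<in> f ` V" "y \<in> f ` V" "Y.gap \<le> r' * dist x y"
    and Z: "separated_in (X.gap / (P * r)) C Z" "Z \<subseteq> V" and "P > 0"
  shows "separated_in (zoom_gap P) C' (\<phi>' ` f ` Z)"
proof -
  let ?D = "diameter C"
  have r: "r \<ge> 1" and r': "r' > 0" using X.clone_scale_ge_1[OF V] Y.clone_scale[OF V'(1)] by auto
  obtain u v where uv: "u \<in> V" "v \<in> V" "x = f u" "y = f v" using xy(1,2) by blast
  have "r * dist x y \<le> r * (K * dist u v)"
    using r dist_upper uv X.clone_in_C[OF V] by (intro mult_left_mono) auto
  also have "\<dots> \<le> K * ?D"
    using mult_left_mono[OF X.clone_diameter[OF V uv(1,2)], of K] K_pos by (simp add: ac_simps)
  finally have rd: "r * dist x y \<le> K * ?D" .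
  have "r * Y.gap \<le> r * (r' * dist x y)" using xy(3) r by (intro mult_left_mono) auto
  also have "\<dots> \<le> r' * (K * ?D)"
    using mult_left_mono[OF rd, of r'] r' by (simp add: ac_simps)
  \<comment> \<open>The image of \<open>V\<close> has size at most
    \<open>K * diameter C / r\<close>, whereas \<open>r'\<close> enlarges it to size at least
    \<open>Y.gap\<close>. Hence \<open>r'\<close> is at least a constant times
    \<open>r\<close>.\<close>
  finally have scale: "r * (Y.gap / (K * ?D)) \<le> r'"
    using K_pos diameter_C_pos by (simp add: field_simps)
  define \<theta> where "\<theta> = min (X.gap / (P * K) / r) image_gap"
  have "separated_in (1 / K * (X.gap / (P * r))) (f ` C) (f ` Z)"
    using dist_lower K_pos by (intro separated_in_image[OF Z(1)]) auto
  then have "separated_in (X.gap / (P * K) / r) (f ` C) (f ` Z)"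
    by (simp add: ac_simps)
  then have "separated_in \<theta> C' (f ` Z)"
    unfolding \<theta>_def by (intro separated_in_trans[OF image_gap(2)]) auto
  then have "separated_in \<theta> V' (V' \<inter> f ` Z)"
    using Y.clone_in_C[OF V'(1)] by (rule separated_in_Int_subset)
  moreover have "V' \<inter> f ` Z = f ` Z" using Z(2) V'(2) by blast
  ultimately have "separated_in (r' * \<theta>) (\<phi>' ` V') (\<phi>' ` f ` Z)"
    using r' Y.clone_dist[OF V'(1)] by (intro separated_in_image) auto
  moreover have "zoom_gap P \<le> r' * \<theta>"
  proof -
    have "Y.gap / (K * ?D) * min (X.gap / (P * K)) image_gap
        \<le> Y.gap / (K * ?D) * (r * \<theta>)"
    proof (rule mult_left_mono)
      \<comment> \<open>\<open>image_gap\<close> is unaffected by the size of \<open>V\<close>, and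
        multiplying it by \<open>r \<ge> 1\<close> can only increase it.\<close>
      have "image_gap \<le> r * image_gap" using r image_gap(1) by simp
      then show "min (X.gap / (P * K)) image_gap \<le> r * \<theta>"
        using r by (auto simp: \<theta>_def min_def)
      show "0 \<le> Y.gap / (K * ?D)" using Y.gap_pos K_pos diameter_C_pos by simp
    qed
    also have "\<dots> = r * (Y.gap / (K * ?D)) * \<theta>" by simp
    also have "\<dots> \<le> r' * \<theta>"
      using scale X.gap_pos K_pos \<open>P > 0\<close> r image_gap(1)
      by (intro mult_right_mono) (auto simp: \<theta>_def)
    finally show ?thesis by (simp add: zoom_gap_def)
  qed
  ultimately show ?thesis
    by (intro separated_in_trans[OF Y.clone_image_separated[OF V'(1)]]) (auto simp: zoom_gap_def)
qed

section \<open>Ratios of clones, and a clone of constant ratio\<close>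

definition ratio :: "'a set \<Rightarrow> real" where "ratio W = \<nu> W / \<mu> W"

lemma clone_\<mu>_pos: "X.clone V \<phi> r k \<Longrightarrow> \<mu> V > 0"
  and clone_\<nu>_pos: "X.clone V \<phi> r k \<Longrightarrow> \<nu> V > 0"
  using \<mu>_pos \<nu>_pos X.clone_clopen_in X.clone_ne by blast+

lemma clone_ratio_pos: "X.clone V \<phi> r k \<Longrightarrow> ratio V > 0"
  unfolding ratio_def by (intro divide_pos_pos clone_\<mu>_pos clone_\<nu>_pos)

text \<open>Enlarging \<open>V\<close> and its child by \<open>\<phi>\<close>, and their images by
  \<open>\<phi>'\<close>, multiplies the measures by \<open>r powr s\<close> and
  \<open>r' powr s\<close>, which cancel in the quotient. What remains depends on four sets from two
  finite families.\<close>

lemma finite_child_ratios: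
  "\<exists>T. finite T \<and> (\<forall>V \<phi> r k. X.clone V \<phi> r k \<longrightarrow>
      (\<forall>i\<in>X.children (\<phi> ` V). ratio (V \<inter> \<phi> -` E i) / ratio V \<in> T))"
proof -
  \<comment> \<open>The largest scale factor of a clone map: a clone of scale \<open>r\<close> and
    all its children are then separated by \<open>X.gap / (P * r)\<close>.\<close>
  define P where "P = Max (\<rho> ` {..<m})"
  have P: "\<rho> i \<le> P" if "i < m" for i using that by (simp add: P_def)
  have P1: "P > 1" using P[of 0] X.scale_gt_1[of 0] X.m_pos by linarith
  define F where "F = {Z. separated_in X.gap C Z}"
  define F' where "F' = {Z. separated_in (zoom_gap P) C' Z}"
  let ?h = "real_hausdorff_measure s"
  define T where "T = (\<lambda>(Z', Y', Z, Y). (real_hausdorff_measure s Z' / real_hausdorff_measure s Y')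
      / (real_hausdorff_measure s Z / real_hausdorff_measure s Y)) ` (F' \<times> F' \<times> F \<times> F)"
  have "ratio (V \<inter> \<phi> -` E i) / ratio V \<in> T"
    if V: "X.clone V \<phi> r k" and i: "i \<in> X.children (\<phi> ` V)" for V \<phi> r k i
  proof -
    let ?W = "V \<inter> \<phi> -` E i"
    have i': "i < m" "E i \<subseteq> \<phi> ` V" using i by (auto simp: X.children_def)
    have r: "r > 0" using X.clone_scale[OF V] .
    obtain u v where uv: "u \<in> V" "v \<in> V" "u \<noteq> v" using X.clone_two_points[OF V] .
    have "f ` V \<subseteq> C'" using X.clone_in_C[OF V] clopen_in_subset[OF range_clopen] by blast
    moreover have "f u \<noteq> f v" using uv X.clone_in_C[OF V] inj_onD[OF inj_f] by blast
    ultimately obtain V' \<phi>' r' k' x y where V': "Y.clone V' \<phi>' r' k'" "f ` V \<subseteq> V'"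
      and xy: "x \<in> f ` V" "y \<in> f ` V" "Y.gap \<le> r' * dist x y"
      using Y.smallest_clone[of "f ` V" "f u" "f v"] uv by blast
    have r': "r' > 0" using Y.clone_scale[OF V'(1)] .
    have sim: "similarity_map V (\<phi> ` V) \<phi> r" "similarity_map ?W (E i) \<phi> r"
      using X.clone_similarity[OF V] similarity_map_vimage[OF X.clone_similarity[OF V] i'(2)] by auto
    have sim': "similarity_map (f ` Z) (\<phi>' ` f ` Z) \<phi>' r'" if "Z \<subseteq> V" for Z
      using that V' Y.clone_dist[OF V'(1)] r' unfolding similarity_map_def by blast
    have \<mu>: "?h (\<phi> ` V) = r powr s * \<mu> V" "?h (E i) = r powr s * \<mu> ?W"
      unfolding \<mu>_def by (rule real_hausdorff_measure_similarity[OF sim(1) s_nonneg']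
          real_hausdorff_measure_similarity[OF sim(2) s_nonneg'])+
    have \<nu>: "?h (\<phi>' ` f ` V) = r' powr s * \<nu> V" "?h (\<phi>' ` f ` ?W) = r' powr s * \<nu> ?W"
      unfolding \<nu>_def by (rule real_hausdorff_measure_similarity[OF sim'[OF order_refl] s_nonneg']
          real_hausdorff_measure_similarity[OF sim'[OF Int_lower1] s_nonneg'])+
    have "ratio ?W / ratio V = (?h (\<phi>' ` f ` ?W) / ?h (\<phi>' ` f ` V)) / (?h (E i) / ?h (\<phi> ` V))"
      unfolding \<mu> \<nu> ratio_def using r r' by simp
    moreover have "E i \<in> F" "\<phi> ` V \<in> F"
      using X.gap_clone[OF i'(1)] X.clone_image_separated[OF V] by (auto simp: F_def)
    moreover have "\<phi>' ` f ` V \<in> F'"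
    proof -
      have "X.gap / (P * r) \<le> X.gap / r"
        using X.gap_pos P1 r by (intro divide_left_mono) auto
      then have "separated_in (X.gap / (P * r)) C V"
        using separated_in_weaken X.clone_separated[OF V] by blast
      then show ?thesis
        unfolding F'_def using zoomed_image_separated[OF V V' xy _ order_refl, of P] P1 by simp
    qed
    moreover have "\<phi>' ` f ` ?W \<in> F'"
    proof -
      have "X.gap / (P * r) \<le> X.gap / (\<rho> i * r)"
        using X.gap_pos P1 r P[OF i'(1)] X.scale_gt_1[OF i'(1)]
        by (intro divide_left_mono mult_right_mono) auto
      then have "separated_in (X.gap / (P * r)) C ?W"
        using separated_in_weaken X.clone_separated[OF X.clone_child[OF V i]] by blast
      then show ?thesis
        unfolding F'_def using zoomed_image_separated[OF V V' xy, of P ?W] P1 by simp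
    qed
    ultimately show ?thesis
      unfolding T_def by (intro image_eqI[of _ _ "(\<phi>' ` f ` ?W, \<phi>' ` f ` V, E i, \<phi> ` V)"]) auto
  qed
  moreover have "finite F" "finite F'"
    using finite_separated_subsets X.compact_C Y.compact_C X.gap_pos zoom_gap_pos[of P] P1
    by (auto simp: F_def F'_def)
  then have "finite T" by (simp add: T_def)
  ultimately show ?thesis by (intro exI[of _ T]) simp
qed

text \<open>A clone whose ratio is within the smallest factor \<open>t > 1\<close> of the supremum cannot have a
  child of larger ratio, and as the ratio of a clone averages those of its children, all its
  descendants share its ratio.\<close>

lemma constant_ratio_clone:
  "\<exists>V \<phi> r k c. X.clone V \<phi> r k \<and> c > 0 \<and> (\<forall>W. clopen_in C W \<longrightarrow> \<nu> (W \<inter> V) = c * \<mu> (W \<inter> V))"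
proof -
  define S where "S = {ratio V | V \<phi> r k. X.clone V \<phi> r k}"
  have bdd: "bdd_above S"
  proof (rule bdd_aboveI)
    fix x assume "x \<in> S"
    then obtain V \<phi> r k where V: "x = ratio V" "X.clone V \<phi> r k" by (auto simp: S_def)
    then show "x \<le> K powr s"
      using \<nu>_le[OF X.clone_clopen_in[OF V(2)]] clone_\<mu>_pos[OF V(2)]
      by (simp add: ratio_def divide_le_eq)
  qed
  have RC: "ratio C \<in> S" using X.root by (auto simp: S_def)
  then have Sup_pos: "Sup S > 0"
    using cSup_upper[OF RC bdd] clone_ratio_pos[OF X.root] by linarith
  obtain T where T: "finite T" "\<forall>V \<phi> r k. X.clone V \<phi> r k \<longrightarrow>
      (\<forall>i\<in>X.children (\<phi> ` V). ratio (V \<inter> \<phi> -` E i) / ratio V \<in> T)"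
    using finite_child_ratios by blast
  \<comment> \<open>The element \<open>2\<close> keeps the set non-empty when no factor exceeds
    \<open>1\<close>; any number greater than \<open>1\<close> would do.\<close>
  define t where "t = Min (insert 2 {t \<in> T. t > 1})"
  have t: "t > 1" using T(1) by (auto simp: t_def Min_gr_iff)
  have t_le: "t \<le> u" if "u \<in> T" "u > 1" for u using that T(1) by (auto simp: t_def)
  have "Sup S / t < Sup S" using t Sup_pos by (simp add: divide_less_eq)
  then obtain c where c: "c \<in> S" "Sup S / t < c" using less_cSupD RC by (metis empty_iff)
  then obtain V0 \<phi>0 r0 k0 where V0: "X.clone V0 \<phi>0 r0 k0" "ratio V0 = c" by (auto simp: S_def)
  have c_pos: "c > 0" using clone_ratio_pos V0 by blast
  have child: "ratio (V \<inter> \<phi> -` E i) = c"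
    if V: "X.clone V \<phi> r k" "ratio V = c" "i \<in> X.children (\<phi> ` V)" for V \<phi> r k i
  proof -
    define U where "U j = V \<inter> \<phi> -` E j" for j
    let ?I = "X.children (\<phi> ` V)"
    have U: "X.clone (U j) (\<tau> j \<circ> \<phi>) (\<rho> j * r) (Suc k)" if "j \<in> ?I" for j
      unfolding U_def using X.clone_child[OF V(1) that] .
    have V_eq: "V = (\<Union>j\<in>?I. U j)" unfolding U_def by (rule X.clone_children_cover[OF V(1)])
    have disj: "disjoint_family_on U ?I" unfolding U_def by (rule X.children_disjoint)
    \<comment> \<open>A factor greater than \<open>1\<close> would be at least \<open>t\<close> and
      would lift the ratio of the child above the supremum.\<close>
    have le: "\<nu> (U j) \<le> c * \<mu> (U j)" if j: "j \<in> ?I" for j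
    proof -
      have "ratio (U j) \<le> Sup S" using U[OF j] bdd by (intro cSup_upper) (auto simp: S_def)
      also have "\<dots> < t * c" using c(2) t by (simp add: divide_less_eq mult.commute)
      finally have "ratio (U j) / c < t" using c_pos by (simp add: divide_less_eq)
      moreover have "ratio (U j) / c \<in> T" using T(2) V j unfolding U_def by blast
      ultimately have "ratio (U j) / c \<le> 1" using t_le by (meson not_le)
      then show ?thesis
        using c_pos clone_\<mu>_pos[OF U[OF j]] by (simp add: ratio_def field_simps)
    qed
    have clop: "clopen_in C (U j)" if "j \<in> ?I" for j using X.clone_clopen_in[OF U[OF that]] .
    have "(\<Sum>j\<in>?I. \<nu> (U j)) = \<nu> V"
      using \<nu>_UN[OF X.finite_children clop disj] V_eq by simp
    also have "\<dots> = c * \<mu> V"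
      using V(2) clone_\<mu>_pos[OF V(1)] by (simp add: ratio_def field_simps)
    also have "\<dots> = (\<Sum>j\<in>?I. c * \<mu> (U j))"
      using \<mu>_UN[OF X.finite_children clop disj] V_eq by (simp add: sum_distrib_left)
    \<comment> \<open>The two sums agree while each term on the left is at most its counterpart on
      the right, so the terms agree.\<close>
    finally have "\<nu> (U i) = c * \<mu> (U i)"
      using sum_mono_inv[of "\<lambda>j. \<nu> (U j)" ?I "\<lambda>j. c * \<mu> (U j)" i] le V(3) by simp
    then show ?thesis
      using clone_\<mu>_pos[OF U[OF V(3)]] unfolding U_def by (simp add: ratio_def)
  qed
  have "\<nu> (W \<inter> V0) = c * \<mu> (W \<inter> V0)" if W: "clopen_in C W" for W
  proof -
    obtain \<epsilon> where \<epsilon>: "\<epsilon> > 0" "separated_in \<epsilon> C W"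
      using clopen_in_imp_separated_in[OF X.compact_C W] .
    obtain N where N: "\<forall>V \<phi> r k. X.clone V \<phi> r k \<longrightarrow> k \<ge> N \<longrightarrow> (\<forall>x\<in>V. \<forall>y\<in>V. dist x y < \<epsilon>)"
      using X.small_clones[OF \<epsilon>(1)] by blast
    \<comment> \<open>Induction on the number \<open>d\<close> of levels left to depth
      \<open>N\<close>. From depth \<open>N\<close> on, a clone is contained in \<open>W\<close> or
      disjoint from it; before that, the measures are summed over the children.\<close>
    have "\<nu> (W \<inter> V) = c * \<mu> (W \<inter> V)"
      if "X.clone V \<phi> r k" "ratio V = c" "N \<le> k + d" for V \<phi> r k d
      using that
    proof (induction d arbitrary: V \<phi> r k)
      case 0
      show ?case
      proof (cases "W \<inter> V = {}")
        case False
        then obtain x where x: "x \<in> W" "x \<in> V" by blast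
        have "V \<subseteq> W"
        proof
          fix y assume y: "y \<in> V"
          then have "dist x y < \<epsilon>" using N 0 x(2) by auto
          then show "y \<in> W"
            using separated_inD[OF \<epsilon>(2) x(1)] y X.clone_in_C[OF 0(1)] by force
        qed
        then have "W \<inter> V = V" by blast
        then show ?thesis
          using 0(2) clone_\<mu>_pos[OF 0(1)] by (simp add: ratio_def field_simps)
      qed simp
    next
      case (Suc d)
      let ?I = "X.children (\<phi> ` V)"
      let ?U = "\<lambda>j. W \<inter> (V \<inter> \<phi> -` E j)"
      have eq: "W \<inter> V = (\<Union>j\<in>?I. ?U j)" using X.clone_children_cover[OF Suc.prems(1)] by blast
      have clop: "clopen_in C (?U j)" if "j \<in> ?I" for j
        using clopen_in_Int[OF W X.clone_clopen_in[OF X.clone_child[OF Suc.prems(1) that]]] .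
      have disj: "disjoint_family_on ?U ?I"
        using X.children_disjoint[of V \<phi> "\<phi> ` V"] unfolding disjoint_family_on_def by blast
      have IH: "\<nu> (?U j) = c * \<mu> (?U j)" if "j \<in> ?I" for j
        using Suc.IH[OF X.clone_child[OF Suc.prems(1) that] child[OF Suc.prems(1,2) that]]
          Suc.prems(3) by simp
      have "\<nu> (W \<inter> V) = (\<Sum>j\<in>?I. \<nu> (?U j))"
        unfolding eq by (rule \<nu>_UN[OF X.finite_children clop disj])
      also have "\<dots> = (\<Sum>j\<in>?I. c * \<mu> (?U j))"
        by (intro sum.cong refl IH)
      also have "\<dots> = c * \<mu> (W \<inter> V)"
        unfolding eq sum_distrib_left[symmetric]
        by (subst \<mu>_UN[OF X.finite_children clop disj]) simp_all
      finally show ?case .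
    qed
    from this[OF V0, of N] show ?thesis by simp
  qed
  then show ?thesis using V0(1) c_pos by blast
qed

end

subsection \<open>The clopen invariant\<close>

text \<open>The exponent is explicit here, so that clopens of the two Cantor sets are measured with
  one and the same \<open>s\<close>.\<close>

definition clopen_measure_set :: "real \<Rightarrow> 'a::metric_space set \<Rightarrow> real set" where
  "clopen_measure_set s X = {real_hausdorff_measure s U | U. clopen_in X U}"

text \<open>One half of \<open>similar_sets\<close>. It is a preorder, so comparisons can be chained
  through intermediate sets.\<close>

definition dominated :: "real set \<Rightarrow> real set \<Rightarrow> bool" where
  "dominated S T \<longleftrightarrow> (\<exists>\<alpha>. \<alpha> \<noteq> 0 \<and> (\<lambda>x. \<alpha> * x) ` S \<subseteq> T)"

lemma similar_sets_iff_dominated: "similar_sets S T \<longleftrightarrow> dominated S T \<and> dominated T S"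
  by (auto simp: similar_sets_def dominated_def)

lemma dominated_subset: "S \<subseteq> T \<Longrightarrow> dominated S T"
  unfolding dominated_def by (intro exI[of _ 1]) auto

lemma dominated_trans:
  assumes "dominated S T" "dominated T R" shows "dominated S R"
proof -
  obtain \<alpha> where \<alpha>: "\<alpha> \<noteq> 0" "(\<lambda>x. \<alpha> * x) ` S \<subseteq> T"
    using assms(1) by (auto simp: dominated_def)
  obtain \<beta> where \<beta>: "\<beta> \<noteq> 0" "(\<lambda>x. \<beta> * x) ` T \<subseteq> R"
    using assms(2) by (auto simp: dominated_def)
  have "(\<lambda>x. \<beta> * \<alpha> * x) ` S = (\<lambda>x. \<beta> * x) ` (\<lambda>x. \<alpha> * x) ` S"
    by (simp add: image_image mult.assoc)
  also have "\<dots> \<subseteq> R" using image_mono[OF \<alpha>(2)] \<beta>(2) by (rule order_trans)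
  finally show ?thesis
    unfolding dominated_def using \<alpha>(1) \<beta>(1) by (intro exI[of _ "\<beta> * \<alpha>"]) simp
qed

lemma clopen_invariant_eqI:
  assumes "dominated (clopen_measures C X) (clopen_measures C' Y)"
    and "dominated (clopen_measures C' Y) (clopen_measures C X)"
  shows "clopen_invariant C X = clopen_invariant C' Y"
proof -
  have "similar_sets (clopen_measures C X) T \<longleftrightarrow> similar_sets (clopen_measures C' Y) T" for T
    unfolding similar_sets_iff_dominated
    using dominated_trans[OF assms(1), of T] dominated_trans[OF assms(2), of T]
      dominated_trans[OF _ assms(1), of T] dominated_trans[OF _ assms(2), of T] by blast
  then show ?thesis by (simp add: clopen_invariant_def)
qed

lemma clopen_measure_set_mono:
  "clopen_in X Y \<Longrightarrow> dominated (clopen_measure_set s Y) (clopen_measure_set s X)"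
  unfolding clopen_measure_set_def by (intro dominated_subset) (blast intro: clopen_in_trans)

text \<open>Pulling a clopen of \<open>Y\<close> back to the copy divides its measure by
  \<open>r powr s\<close>, whose inverse is the scalar.\<close>

lemma clopen_measure_set_copy:
  assumes "has_clopen_copy X Y" "s \<ge> 0"
  shows "dominated (clopen_measure_set s Y) (clopen_measure_set s X)"
proof -
  obtain V \<phi> r where V: "clopen_in X V" "similarity_map V Y \<phi> r"
    using assms(1) by (auto simp: has_clopen_copy_def)
  have r: "r > 0" using V(2) by (simp add: similarity_map_def)
  have "inverse (r powr s) * real_hausdorff_measure s W \<in> clopen_measure_set s X"
    if W: "clopen_in Y W" for W
  proof -
    have eq: "real_hausdorff_measure s W = r powr s * real_hausdorff_measure s (V \<inter> \<phi> -` W)"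
      using similarity_map_vimage[OF V(2) clopen_in_subset[OF W]] assms(2)
      by (rule real_hausdorff_measure_similarity)
    have "inverse (r powr s) * real_hausdorff_measure s W = real_hausdorff_measure s (V \<inter> \<phi> -` W)"
      unfolding eq using r by simp
    moreover have "clopen_in X (V \<inter> \<phi> -` W)"
      using clopen_in_trans[OF V(1) clopen_in_similarity_vimage[OF V(2) W]] .
    ultimately show ?thesis unfolding clopen_measure_set_def by blast
  qed
  then show ?thesis
    unfolding dominated_def clopen_measure_set_def[of s Y] using r
    by (intro exI[of _ "inverse (r powr s)"]) auto
qed

text \<open>Infinite measures are turned into \<open>0\<close> by \<open>enn2real\<close>, and the
  empty clopen makes sure that \<open>0\<close> occurs.\<close>

lemma (in multi_model_cantor_set) clopen_measure_set_degenerate: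
  assumes "hausdorff_measure s C = 0 \<or> (\<forall>U. clopen_in C U \<and> U \<noteq> {} \<longrightarrow> hausdorff_measure s U = \<infinity>)"
    and "j < n"
  shows "clopen_measure_set s (A j) = {0}"
proof -
  have "real_hausdorff_measure s U = 0" if "clopen_in (A j) U" for U
  proof -
    have "clopen_in C U" using clopen_in_trans[OF model_clopen[OF assms(2)] that] .
    then show ?thesis
      using assms(1) hausdorff_measure_mono[of U C s] clopen_in_subset[of C U]
      by (cases "U = {}") (auto simp: real_hausdorff_measure_def infinity_ennreal_def)
  qed
  moreover have "0 \<in> clopen_measure_set s (A j)"
    unfolding clopen_measure_set_def using clopen_in_empty real_hausdorff_measure_empty
    by (metis (mono_tags, lifting) mem_Collect_eq)
  ultimately show ?thesis unfolding clopen_measure_set_def by blast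
qed

section \<open>Comparison of the models of the two Cantor sets\<close>

context bilipschitz_embedding_measure
begin

text \<open>On a clopen \<open>Z\<close> the map \<open>f\<close> multiplies measures by a constant,
  so \<open>Z\<close> and its image dominate each other. They are linked to the models on either
  side: every model has a copy in each non-empty clopen, a model dominates its clopens, and any two
  models of one Cantor set dominate each other.\<close>

lemma model_clopen_measures_dominated:
  assumes j: "j < n" and j': "j' < n'"
  shows "dominated (clopen_measure_set s (A j)) (clopen_measure_set s (A' j'))"
    and "dominated (clopen_measure_set s (A' j')) (clopen_measure_set s (A j))"
proof -
  let ?S = "\<lambda>X :: 'a set. clopen_measure_set s X" and ?S' = "\<lambda>X :: 'b set. clopen_measure_set s X"
  obtain V \<phi> r k c where V: "X.clone V \<phi> r k" "c > 0"
    "\<And>W. clopen_in C W \<Longrightarrow> \<nu> (W \<inter> V) = c * \<mu> (W \<inter> V)"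
    using constant_ratio_clone by blast
  obtain x where x: "x \<in> V" using X.clone_ne[OF V(1)] by blast
  then have xC: "x \<in> C" using X.clone_in_C[OF V(1)] by blast
  then obtain i where i: "i < n" "x \<in> A i" using X.model_cover by blast
  have "f x \<in> C'" using xC clopen_in_subset[OF range_clopen] by blast
  then obtain i' where i': "i' < n'" "f x \<in> A' i'" using Y.model_cover by blast
  \<comment> \<open>The clone \<open>V\<close> is cut down to lie in one model of \<open>C\<close>
    and to have its image in one model of \<open>C'\<close>; the point \<open>x\<close> keeps it
    non-empty.\<close>
  define Z where "Z = V \<inter> A i \<inter> (C \<inter> f -` A' i')"
  have Z: "clopen_in C Z"
    unfolding Z_def by (intro clopen_in_Int[OF clopen_in_Int] X.clone_clopen_in[OF V(1)]
        X.model_clopen[OF i(1)] clopen_in_vimage[OF Y.model_clopen[OF i'(1)]])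
  have Z_ne: "Z \<noteq> {}" using x xC i i' by (auto simp: Z_def)
  have Z_sub: "Z \<subseteq> A i" "f ` Z \<subseteq> A' i'" "Z \<subseteq> V" "Z \<subseteq> C" by (auto simp: Z_def)
  have fZ: "clopen_in C' (f ` Z)" by (rule clopen_in_image[OF Z])
  have ZA: "clopen_in (A i) Z" and fZA: "clopen_in (A' i') (f ` Z)"
    using clopen_in_subset_iff X.model_clopen Y.model_clopen i(1) i'(1) Z fZ Z_sub by blast+
  have scale: "real_hausdorff_measure s (f ` W) = c * real_hausdorff_measure s W"
    if "clopen_in Z W" for W
  proof -
    have "W \<inter> V = W" using clopen_in_subset[OF that] Z_sub(3) by blast
    then show ?thesis
      using V(3)[OF clopen_in_trans[OF Z that]] by (simp add: \<mu>_def \<nu>_def)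
  qed
  have "dominated (?S Z) (?S' (f ` Z))"
  proof -
    have "c * real_hausdorff_measure s W \<in> ?S' (f ` Z)" if W: "clopen_in Z W" for W
    proof -
      have "clopen_in (f ` Z) (f ` W)"
        using clopen_in_subset_iff[OF fZ] clopen_in_image[OF clopen_in_trans[OF Z W]]
          clopen_in_subset[OF W] by blast
      then show ?thesis
        using scale[OF W] unfolding clopen_measure_set_def by (metis (mono_tags, lifting) mem_Collect_eq)
    qed
    then show ?thesis
      unfolding dominated_def clopen_measure_set_def[of s Z] using V(2) by (intro exI[of _ c]) auto
  qed
  moreover have "dominated (?S' (f ` Z)) (?S Z)"
  proof -
    have "inverse c * real_hausdorff_measure s W' \<in> ?S Z" if W': "clopen_in (f ` Z) W'" for W'
    proof -
      define W where "W = Z \<inter> (C \<inter> f -` W')"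
      have "clopen_in C W"
        unfolding W_def by (rule clopen_in_Int[OF Z clopen_in_vimage[OF clopen_in_trans[OF fZ W']]])
      then have W: "clopen_in Z W"
        using clopen_in_subset_iff[OF Z] unfolding W_def by blast
      have "f ` W = W'" using clopen_in_subset[OF W'] Z_sub(4) unfolding W_def by blast
      then have "inverse c * real_hausdorff_measure s W' = real_hausdorff_measure s W"
        using scale[OF W] V(2) by simp
      then show ?thesis using W unfolding clopen_measure_set_def by blast
    qed
    then show ?thesis
      unfolding dominated_def clopen_measure_set_def[of s "f ` Z"] using V(2)
      by (intro exI[of _ "inverse c"]) auto
  qed
  moreover have "dominated (?S (A j)) (?S Z)" "dominated (?S' (A' j')) (?S' (f ` Z))"
    using X.clopen_has_model_copy[OF Z Z_ne j] Y.clopen_has_model_copy[OF fZ _ j'] Z_ne s_nonneg'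
    by (auto intro: clopen_measure_set_copy)
  moreover have "dominated (?S Z) (?S (A i))" "dominated (?S' (f ` Z)) (?S' (A' i'))"
    using clopen_measure_set_mono ZA fZA by blast+
  moreover have "dominated (?S (A i)) (?S (A j))" "dominated (?S' (A' i')) (?S' (A' j'))"
    using clopen_measure_set_copy X.model_copy[OF i(1) j] Y.model_copy[OF i'(1) j'] s_nonneg' by blast+
  ultimately show "dominated (?S (A j)) (?S' (A' j'))" "dominated (?S' (A' j')) (?S (A j))"
    using dominated_trans by meson+
qed

end

section \<open>Equality of the invariants, degenerate cases included\<close>

theorem (in bilipschitz_embedding) clopen_invariant_eq:
  assumes j: "j < n" and j': "j' < n'"
  shows "clopen_invariant C (A j) = clopen_invariant C' (A' j')"
proof -
  define s where "s = enn2real (hausdorff_dimension C)"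
  have s: "s \<ge> 0" by (simp add: s_def)
  \<comment> \<open>Equality of the dimensions lets both invariants be computed with the same
    exponent.\<close>
  have eq: "clopen_measures C X = clopen_measure_set s X"
    "clopen_measures C' Y = clopen_measure_set s Y" for X Y
    by (simp_all add: clopen_measures_def clopen_measure_set_def real_hausdorff_measure_def
        s_def hausdorff_dimension_eq)
  have "dominated (clopen_measure_set s (A j)) (clopen_measure_set s (A' j')) \<and>
      dominated (clopen_measure_set s (A' j')) (clopen_measure_set s (A j))"
  proof (cases "hausdorff_measure s C = 0 \<or> hausdorff_measure s C = \<infinity>")
    case True
    have "clopen_measure_set s (A j) = {0}"
      using True X.hausdorff_measure_clopen_infinite_iff[OF _ _ s] j
      by (intro X.clopen_measure_set_degenerate) auto
    moreover have "clopen_measure_set s (A' j') = {0}"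
      using True Y.hausdorff_measure_clopen_infinite_iff[OF _ _ s] j'
        measure_zero_iff[OF s] measure_infinite_iff[OF s]
      by (intro Y.clopen_measure_set_degenerate) auto
    ultimately show ?thesis by (simp add: dominated_subset)
  next
    case False
    then interpret bilipschitz_embedding_measure C n A m E \<tau> \<rho> C' n' A' m' E' \<tau>' \<rho>' f K s
      using s by unfold_locales auto
    show ?thesis using model_clopen_measures_dominated[OF j j'] by blast
  qed
  then show ?thesis by (intro clopen_invariant_eqI) (simp_all add: eq)
qed

theorem corollary4:
  fixes C :: "'a::metric_space set" and C' :: "'b::metric_space set"
    and n m n' m' :: nat
    and A E :: "nat \<Rightarrow> 'a set" and A' E' :: "nat \<Rightarrow> 'b set"
    and \<tau> :: "nat \<Rightarrow> 'a \<Rightarrow> 'a" and \<tau>' :: "nat \<Rightarrow> 'b \<Rightarrow> 'b"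
    and \<rho> \<rho>' :: "nat \<Rightarrow> real"
  assumes "multi_model_cantor_set C n A m E \<tau> \<rho>"
    and "has_irreducible_matrix n A m E \<tau> \<rho>"
    and "multi_model_cantor_set C' n' A' m' E' \<tau>' \<rho>'"
    and "has_irreducible_matrix n' A' m' E' \<tau>' \<rho>'"
    and "\<exists>f U. clopen_in C' U \<and> bilipschitz_on C f \<and> f ` C = U"
  shows "\<forall>j<n. \<forall>j'<n'. clopen_invariant C (A j) = clopen_invariant C' (A' j')"
proof -
  obtain f where f: "clopen_in C' (f ` C)" "bilipschitz_on C f" using assms(5) by blast
  obtain K where K: "K > 0"
    "\<And>x y. x \<in> C \<Longrightarrow> y \<in> C \<Longrightarrow> 1 / K * dist x y \<le> dist (f x) (f y)"
    "\<And>x y. x \<in> C \<Longrightarrow> y \<in> C \<Longrightarrow> dist (f x) (f y) \<le> K * dist x y"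
    using f(2) unfolding bilipschitz_on_def by blast
  have "bilipschitz_embedding C n A m E \<tau> \<rho> C' n' A' m' E' \<tau>' \<rho>' f K"
    by (intro bilipschitz_embedding.intro irreducible_cantor_set.intro
        irreducible_cantor_set_axioms.intro bilipschitz_embedding_axioms.intro assms f(1) K)
  then show ?thesis using bilipschitz_embedding.clopen_invariant_eq by blast
qed

end
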